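(* Let $w\in W$. In the poset $(\Phi^1(w),\preceq_w)$, the minimal elements are exactly the left-descent roots in $\Phi^L(w)$ and the maximal elements are exactly the right-descent roots in $\Phi^R(w)$. In other words, for every $\beta\in\Phi^1(w)$ there exist $\alpha\in\Phi^L(w)$ and $\gamma\in\Phi^R(w)$ such that $\alpha\preceq_w\beta\preceq_w\gamma$.
   Context: Let $(W,S)$ be a Coxeter system with length function $\ell$, realized via a geometric representation on a real vector space $V$ with symmetric bilinear form $B$, simple roots $\Delta=\{\alpha_s\mid s\in S\}$ ($B(\alpha_s,\alpha_s)=1$), root system $\Phi=W(\Delta)$, positive roots $\Phi^+=\Phi\cap\operatorname{cone}(\Delta)$, $\Phi^-=-\Phi^+$. For $\beta\in\Phi$, $s_\beta$ is the reflection in $\beta$. $\Phi(w)=\Phi^+\cap w(\Phi^-)$; $\Phi^1(w)=\{\beta\in\Phi^+\mid\ell(s_\beta w)=\ell(w)-1\}$ (short inversions). Left-descent roots: $\Phi^L(w)=\Phi(w)\cap\Delta$. Right-descent roots: $\Phi^R(w)=\{-w(\alpha_s)\mid s\in S,\ \ell(ws)<\ell(w)\}$. For a reflection subgroup $W'$ (subgroup generated by reflections), $\Phi_{W'}=\{\beta\in\Phi\mid s_\beta\in W'\}$ and its canonical simple system is $\Delta_{W'}=\{\alpha\in\Phi^+\mid \Phi(s_\alpha)\cap\Phi_{W'}=\{\alpha\}\}$. For $\alpha,\beta\in\Phi$ with $\mathbb R\alpha\ne\mathbb R\beta$, $\mathcal M_{\alpha,\beta}$ denotes the unique maximal dihedral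 reflection subgroup containing $s_\alpha,s_\beta$ (its root subsystem is $(\mathbb R\alpha\oplus\mathbb R\beta)\cap\Phi$). For $\alpha,\beta\in\Phi^1(w)$, write $\alpha\,\triangleleft_w\,\beta$ if $\beta\notin\Delta_{\mathcal M_{\alpha,\beta}}$; $\preceq_w$ is the reflexive and transitive closure of $\triangleleft_w$ on $\Phi^1(w)$ (it is a partial order). *)

theory Defs
  imports "HOL-Analysis.Analysis" "HOL-Algebra.Algebra"
begin

text \<open>
  Coxeter systems: \<open>S\<close> is a set of involutions generating \<open>W\<close>, and the relations
  \<open>(s t)\<^bsup>m(s,t)\<^esup> = 1\<close>, with \<open>m(s,t)\<close> the order of \<open>s t\<close>, present \<open>W\<close>: two words in \<open>S\<close> with the
  same value are connected by inserting and deleting relators. Since \<open>m(s,s) = 1\<close>, the words \<open>[s, s]\<close>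
  are among the relators, so words in \<open>S\<close> (without formal inverses) suffice for the group
  presentation. The library's \<open>ord\<close> is \<open>0\<close> for elements of infinite order; the relator is then
  the empty word, which imposes no relation.
\<close>

definition word_value :: "('w, 'm) monoid_scheme \<Rightarrow> 'w list \<Rightarrow> 'w" where
  "word_value W u = foldr (\<lambda>x y. x \<otimes>\<^bsub>W\<^esub> y) u \<one>\<^bsub>W\<^esub>"

definition coxeter_relator :: "('w, 'm) monoid_scheme \<Rightarrow> 'w \<Rightarrow> 'w \<Rightarrow> 'w list" where
  "coxeter_relator W s t = concat (replicate (group.ord W (s \<otimes>\<^bsub>W\<^esub> t)) [s, t])"

inductive relator_insertion :: "('w, 'm) monoid_scheme \<Rightarrow> 'w set \<Rightarrow> 'w list \<Rightarrow> 'w list \<Rightarrow> bool"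
  for W and S where
  "u \<in> lists S \<Longrightarrow> v \<in> lists S \<Longrightarrow> s \<in> S \<Longrightarrow> t \<in> S
    \<Longrightarrow> relator_insertion W S (u @ v) (u @ coxeter_relator W s t @ v)"

locale coxeter_system = group W for W :: "'w monoid" (structure) +
  fixes S :: "'w set"
  assumes gens_subset: "S \<subseteq> carrier W"
    and gens_involution: "s \<in> S \<Longrightarrow> ord s = 2"
    and gens_generate: "generate W S = carrier W"
    and presentation: "u \<in> lists S \<Longrightarrow> v \<in> lists S \<Longrightarrow> word_value W u = word_value W v
      \<Longrightarrow> equivclp (relator_insertion W S) u v"
begin

definition len :: "'w \<Rightarrow> nat" where
  "len w = (LEAST n. \<exists>u \<in> lists S. length u = n \<and> word_value W u = w)"

end

definition reflection :: "('v::real_vector \<Rightarrow> 'v \<Rightarrow> real) \<Rightarrow> 'v \<Rightarrow> 'v \<Rightarrow> 'v" where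
  "reflection B a v = v - (2 * B v a / B a a) *\<^sub>R a"

text \<open>
  The simple roots are only required to be positively independent, and \<open>B(\<alpha>\<^sub>s, \<alpha>\<^sub>t)\<close> may be any
  number \<open>\<le> -1\<close> if \<open>s t\<close> has infinite order. The classical (Tits) geometric representation is the
  case where the simple roots are a basis and this number is \<open>-1\<close>.
\<close>

locale geometric_representation = coxeter_system W S + group_action W UNIV \<rho>
  for W :: "'w monoid" (structure) and S :: "'w set"
    and \<rho> :: "'w \<Rightarrow> 'v::real_vector \<Rightarrow> 'v" +
  fixes B :: "'v \<Rightarrow> 'v \<Rightarrow> real" and \<alpha> :: "'w \<Rightarrow> 'v"
  assumes form_bilinear: "bilinear B"
    and form_symmetric: "B x y = B y x"
    and simple_norm: "s \<in> S \<Longrightarrow> B (\<alpha> s) (\<alpha> s) = 1"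
    and simple_finite: "s \<in> S \<Longrightarrow> t \<in> S \<Longrightarrow> s \<noteq> t \<Longrightarrow> ord (s \<otimes> t) \<noteq> 0
      \<Longrightarrow> B (\<alpha> s) (\<alpha> t) = - cos (pi / real (ord (s \<otimes> t)))"
    and simple_infinite: "s \<in> S \<Longrightarrow> t \<in> S \<Longrightarrow> s \<noteq> t \<Longrightarrow> ord (s \<otimes> t) = 0
      \<Longrightarrow> B (\<alpha> s) (\<alpha> t) \<le> - 1"
    and simple_pos_independent: "finite F \<Longrightarrow> F \<subseteq> S \<Longrightarrow> (\<And>s. s \<in> F \<Longrightarrow> c s \<ge> 0)
      \<Longrightarrow> (\<Sum>s\<in>F. c s *\<^sub>R \<alpha> s) = 0 \<Longrightarrow> s \<in> F \<Longrightarrow> c s = 0"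
    and rep_gens: "s \<in> S \<Longrightarrow> \<rho> s = reflection B (\<alpha> s)"
begin

definition simple_roots :: "'v set" where
  "simple_roots = \<alpha> ` S"

definition roots :: "'v set" where
  "roots = (\<Union>w \<in> carrier W. \<rho> w ` simple_roots)"

definition pos_roots :: "'v set" where
  "pos_roots = roots \<inter> convex_cone hull simple_roots"

definition neg_roots :: "'v set" where
  "neg_roots = uminus ` pos_roots"

text \<open>The element \<open>s\<^sub>\<beta>\<close> of \<open>W\<close>; it is unique because the representation is faithful.\<close>

definition refl :: "'v \<Rightarrow> 'w" where
  "refl \<beta> = (THE x. x \<in> carrier W \<and> \<rho> x = reflection B \<beta>)"

definition inversions :: "'w \<Rightarrow> 'v set" where
  "inversions w = pos_roots \<inter> \<rho> w ` neg_roots"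

definition short_inversions :: "'w \<Rightarrow> 'v set" where
  "short_inversions w = {\<beta> \<in> pos_roots. len (refl \<beta> \<otimes> w) + 1 = len w}"

definition left_descent_roots :: "'w \<Rightarrow> 'v set" where
  "left_descent_roots w = inversions w \<inter> simple_roots"

definition right_descent_roots :: "'w \<Rightarrow> 'v set" where
  "right_descent_roots w = {- \<rho> w (\<alpha> s) |s. s \<in> S \<and> len (w \<otimes> s) < len w}"

definition subgroup_roots :: "'w set \<Rightarrow> 'v set" where
  "subgroup_roots M = {\<beta> \<in> roots. refl \<beta> \<in> M}"

definition canonical_simple_roots :: "'w set \<Rightarrow> 'v set" where
  "canonical_simple_roots M =
    {a \<in> pos_roots. inversions (refl a) \<inter> subgroup_roots M = {a}}"

definition dihedral_reflection_subgroup :: "'w set \<Rightarrow> bool" where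
  "dihedral_reflection_subgroup M \<longleftrightarrow>
    (\<exists>\<gamma> \<in> roots. \<exists>\<delta> \<in> roots. refl \<gamma> \<noteq> refl \<delta> \<and> M = generate W {refl \<gamma>, refl \<delta>})"

definition max_dihedral :: "'v \<Rightarrow> 'v \<Rightarrow> 'w set" where
  "max_dihedral a b = (THE M. dihedral_reflection_subgroup M \<and> refl a \<in> M \<and> refl b \<in> M \<and>
    (\<forall>M'. dihedral_reflection_subgroup M' \<and> M \<subseteq> M' \<longrightarrow> M' = M))"

definition short_step :: "'w \<Rightarrow> 'v \<Rightarrow> 'v \<Rightarrow> bool" where
  "short_step w a b \<longleftrightarrow> a \<in> short_inversions w \<and> b \<in> short_inversions w \<and>
    span {a} \<noteq> span {b} \<and> b \<notin> canonical_simple_roots (max_dihedral a b)"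

definition short_le :: "'w \<Rightarrow> 'v \<Rightarrow> 'v \<Rightarrow> bool" where
  "short_le w a b \<longleftrightarrow>
    a \<in> short_inversions w \<and> b \<in> short_inversions w \<and> (short_step w)\<^sup>*\<^sup>* a b"

definition minimal_short_inversions :: "'w \<Rightarrow> 'v set" where
  "minimal_short_inversions w =
    {b \<in> short_inversions w. \<not> (\<exists>a \<in> short_inversions w. short_le w a b \<and> a \<noteq> b)}"

definition maximal_short_inversions :: "'w \<Rightarrow> 'v set" where
  "maximal_short_inversions w =
    {b \<in> short_inversions w. \<not> (\<exists>a \<in> short_inversions w. short_le w b a \<and> a \<noteq> b)}"

end

end

theory Submission
  imports Defs
begin

text \<open>
  Pairing \<open>\<lambda>\<close> with \<open>- s\<^sub>\<beta> \<lambda>\<close> on \<open>\<Phi>(s\<^sub>\<beta>)\<close> shows that for an inversion \<open>\<beta>\<close> of \<open>w\<close> the length drops from \<open>w\<close> to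
  \<open>s\<^sub>\<beta> w\<close> by the number of \<open>\<lambda> \<in> \<Phi>(s\<^sub>\<beta>)\<close> for which both \<open>\<lambda>\<close> and \<open>- s\<^sub>\<beta> \<lambda>\<close> are inversions of \<open>w\<close>. So \<open>\<beta>\<close>
  is short iff no pair other than \<open>{\<beta>}\<close> lies in \<open>\<Phi>(w)\<close>, and the short inversions generate the cone of
  \<open>\<Phi>(w)\<close>. The same count holds inside every plane of roots.

  Let \<open>\<beta>\<close> be a short inversion of \<open>w\<close> that is not simple. The cone statement for \<open>x = s\<^sub>\<beta> w\<close> gives a short
  inversion \<open>\<gamma>\<close> of \<open>x\<close> with \<open>s\<^sub>\<beta> \<gamma>\<close> negative, and the first root of the plane of \<open>\<beta>\<close> and \<open>\<gamma>\<close> along a fixed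
  reduced word of \<open>w\<close> is a short inversion strictly below \<open>\<beta>\<close>. Descending along the word ends at a
  left-descent root. The map \<open>\<beta> \<mapsto> - w\<^sup>-\<^sup>1 \<beta>\<close> onto the short inversions of \<open>w\<^sup>-\<^sup>1\<close> reverses all steps,
  which gives the statement for right-descent roots.
\<close>

subsection \<open>Words and length\<close>

context coxeter_system
begin

lemma gens_closed [simp]: "s \<in> S \<Longrightarrow> s \<in> carrier W"
  using gens_subset by blast

lemma gens_square [simp]: "s \<in> S \<Longrightarrow> s \<otimes> s = \<one>"
  using pow_ord_eq_1[of s] gens_involution[of s] gens_closed[of s]
  by (simp add: numeral_2_eq_2)

lemma gens_cancel [simp]: "s \<in> S \<Longrightarrow> x \<in> carrier W \<Longrightarrow> x \<otimes> s \<otimes> s = x"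
  by (simp add: m_assoc)

lemma gens_inv [simp]: "s \<in> S \<Longrightarrow> inv s = s"
  by (simp add: inv_equality)

lemma word_value_Nil [simp]: "word_value W [] = \<one>"
  by (simp add: word_value_def)

lemma word_value_Cons [simp]: "word_value W (x # u) = x \<otimes> word_value W u"
  by (simp add: word_value_def)

lemma word_value_closed [simp]: "u \<in> lists S \<Longrightarrow> word_value W u \<in> carrier W"
  by (induction u) auto

lemma word_value_append:
  "u \<in> lists S \<Longrightarrow> v \<in> lists S \<Longrightarrow> word_value W (u @ v) = word_value W u \<otimes> word_value W v"
  by (induction u) (auto simp: m_assoc)

lemma word_exists:
  assumes "w \<in> carrier W"
  shows "\<exists>u \<in> lists S. word_value W u = w"
proof -
  have "w \<in> generate W S" using assms gens_generate by simp
  then show ?thesis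
  proof (induction rule: generate.induct)
    case one
    then show ?case by (intro bexI[of _ "[]"]) auto
  next
    case (incl h)
    then show ?case by (intro bexI[of _ "[h]"]) auto
  next
    case (inv h)
    then show ?case by (intro bexI[of _ "[h]"]) auto
  next
    case (eng h1 h2)
    then obtain u v where "u \<in> lists S" "v \<in> lists S" "word_value W u = h1" "word_value W v = h2"
      by blast
    then show ?case by (intro bexI[of _ "u @ v"]) (auto simp: word_value_append)
  qed
qed

lemma len_word:
  assumes "w \<in> carrier W"
  obtains u where "u \<in> lists S" "length u = len w" "word_value W u = w"
proof -
  have "\<exists>n. \<exists>u \<in> lists S. length u = n \<and> word_value W u = w"
    using word_exists[OF assms] by blast
  from LeastI_ex[OF this] show ?thesis
    using that unfolding len_def by blast
qed

lemma len_word_value_le: "u \<in> lists S \<Longrightarrow> len (word_value W u) \<le> length u"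
  unfolding len_def by (intro Least_le) blast

lemma len_one [simp]: "len \<one> = 0"
  using len_word_value_le[of "[]"] by simp

lemma len_eq_0: "w \<in> carrier W \<Longrightarrow> len w = 0 \<Longrightarrow> w = \<one>"
  by (erule len_word) simp

lemma len_mult_le:
  assumes "x \<in> carrier W" "y \<in> carrier W"
  shows "len (x \<otimes> y) \<le> len x + len y"
proof -
  obtain u v where "u \<in> lists S" "length u = len x" "word_value W u = x"
    "v \<in> lists S" "length v = len y" "word_value W v = y"
    using assms len_word by metis
  then show ?thesis
    using len_word_value_le[of "u @ v"] by (auto simp: word_value_append)
qed

lemma len_inv:
  assumes "x \<in> carrier W"
  shows "len (inv x) = len x"
proof -
  have inv_word: "inv (word_value W u) = word_value W (rev u)" if "u \<in> lists S" for u
    using that by induction (auto simp: word_value_append inv_mult_group in_lists_conv_set)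
  have "len (inv y) \<le> len y" if y: "y \<in> carrier W" for y
  proof -
    obtain u where u: "u \<in> lists S" "length u = len y" "word_value W u = y"
      using y by (rule len_word)
    then show ?thesis using inv_word[of u] len_word_value_le[of "rev u"] by (auto simp: in_lists_conv_set)
  qed
  from this[of x] this[of "inv x"] show ?thesis using assms by simp
qed

lemma len_gen_le: "s \<in> S \<Longrightarrow> len s \<le> 1"
  using len_word_value_le[of "[s]"] by simp

lemma word_length_parity:
  assumes "u \<in> lists S" "v \<in> lists S" "word_value W u = word_value W v"
  shows "even (length u) = even (length v)"
proof -
  have rel: "even (length (coxeter_relator W s t))" for s t
    by (simp add: coxeter_relator_def length_concat sum_list_replicate)
  have "equivclp (relator_insertion W S) u v" by (rule presentation[OF assms])
  then show ?thesis
  proof (induction rule: equivclp_induct)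
    case base
    then show ?case by simp
  next
    case (step y z)
    have "even (length y) = even (length z)"
      using step(2) by (auto elim!: relator_insertion.cases simp: rel)
    then show ?case using step by simp
  qed
qed

lemma len_mult_gen:
  assumes "w \<in> carrier W" "s \<in> S"
  shows "len (w \<otimes> s) = len w + 1 \<or> len w = len (w \<otimes> s) + 1"
proof -
  obtain u where u: "u \<in> lists S" "length u = len w" "word_value W u = w"
    using assms len_word by metis
  obtain v where v: "v \<in> lists S" "length v = len (w \<otimes> s)" "word_value W v = w \<otimes> s"
    using assms len_word[of "w \<otimes> s"] by auto
  have "even (length (u @ [s])) = even (length v)"
    by (rule word_length_parity) (use u v assms in \<open>auto simp: word_value_append\<close>)
  then have "len w \<noteq> len (w \<otimes> s)" using u v by auto
  moreover have "len (w \<otimes> s) \<le> len w + 1"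
    using len_mult_le[of w s] len_gen_le[of s] assms by simp
  moreover have "len w \<le> len (w \<otimes> s) + 1"
    using len_mult_le[of "w \<otimes> s" s] len_gen_le[of s] assms by simp
  ultimately show ?thesis by linarith
qed

lemma right_descent_exists:
  assumes "w \<in> carrier W" "w \<noteq> \<one>"
  obtains s where "s \<in> S" "len w = len (w \<otimes> s) + 1"
proof -
  obtain u where u: "u \<in> lists S" "length u = len w" "word_value W u = w"
    using assms len_word by metis
  have "u \<noteq> []" using u assms by auto
  then obtain v s where uv: "u = v @ [s]" by (metis rev_exhaust)
  then have s: "s \<in> S" "v \<in> lists S" using u by auto
  then have "w = word_value W v \<otimes> s" using u uv by (auto simp: word_value_append)
  then have "w \<otimes> s = word_value W v" using s by simp
  then have "len (w \<otimes> s) < len w" using len_word_value_le[OF s(2)] u uv by simp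
  then show ?thesis using that[of s] len_mult_gen[OF assms(1) s(1)] s by linarith
qed

text \<open>Letters are prepended, so that the product always ends in \<open>t\<close>; the parity picks its first letter.\<close>

fun alternating :: "'w \<Rightarrow> 'w \<Rightarrow> nat \<Rightarrow> 'w" where
  "alternating s t 0 = \<one>"
| "alternating s t (Suc k) = (if even k then t else s) \<otimes> alternating s t k"

lemma alternating_closed [simp]:
  "s \<in> S \<Longrightarrow> t \<in> S \<Longrightarrow> alternating s t k \<in> carrier W"
  by (induction k) auto

lemma alternating_Suc_right:
  "s \<in> S \<Longrightarrow> t \<in> S \<Longrightarrow> alternating s t (Suc k) = alternating t s k \<otimes> t"
proof (induction k)
  case (Suc k)
  have "alternating s t (Suc (Suc k)) = (if even (Suc k) then t else s) \<otimes> alternating s t (Suc k)"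
    by simp
  also have "\<dots> = (if even k then s else t) \<otimes> (alternating t s k \<otimes> t)"
    by (subst Suc.IH[OF Suc.prems]) auto
  also have "\<dots> = alternating t s (Suc k) \<otimes> t"
    using Suc.prems by (simp add: m_assoc)
  finally show ?case .
qed simp

lemma len_alternating_le: "s \<in> S \<Longrightarrow> t \<in> S \<Longrightarrow> len (alternating s t k) \<le> k"
proof (induction k)
  case (Suc k)
  then show ?case
    using len_mult_le[of "if even k then t else s" "alternating s t k"]
      len_gen_le[of "if even k then t else s"] by auto
qed simp

lemma alternating_even:
  "s \<in> S \<Longrightarrow> t \<in> S \<Longrightarrow> alternating s t (2 * j) = (s \<otimes> t) [^] j"
proof (induction j)
  case (Suc j)
  have "alternating s t (2 * Suc j) = s \<otimes> (t \<otimes> alternating s t (2 * j))"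
    by simp
  also have "\<dots> = (s \<otimes> t) \<otimes> (s \<otimes> t) [^] j"
    using Suc by (simp add: m_assoc)
  also have "\<dots> = (s \<otimes> t) [^] Suc j"
    using Suc.prems by (intro nat_pow_Suc2[symmetric]) simp
  finally show ?case .
qed simp

lemma alternating_braid:
  assumes s: "s \<in> S" and t: "t \<in> S" and one: "(s \<otimes> t) [^] m = \<one>"
  shows "alternating s t m = alternating t s m"
proof -
  have st: "s \<otimes> t \<in> carrier W" "t \<otimes> s \<in> carrier W" using s t by auto
  have inv_pow: "(t \<otimes> s) [^] j = inv ((s \<otimes> t) [^] j)" for j :: nat
    using s t by (simp add: inv_mult_group nat_pow_inv[symmetric])
  show ?thesis
  proof (cases "even m")
    case True
    then obtain j where m: "m = 2 * j" by blast
    have "(s \<otimes> t) [^] j \<otimes> (s \<otimes> t) [^] j = \<one>"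
      using one st by (simp add: nat_pow_mult m mult_2)
    then have "inv ((s \<otimes> t) [^] j) = (s \<otimes> t) [^] j"
      using st by (simp add: inv_equality)
    then show ?thesis
      using alternating_even[OF s t, of j] alternating_even[OF t s, of j] inv_pow m by simp
  next
    case False
    then obtain j where m: "m = Suc (2 * j)" by (metis oddE Suc_eq_plus1)
    let ?p = "(s \<otimes> t) [^] j"
    have p: "?p \<in> carrier W" using st by simp
    have lhs: "alternating s t m = t \<otimes> ?p" and rhs: "alternating t s m = ?p \<otimes> s"
      using alternating_even[OF s t, of j] alternating_Suc_right[OF t s, of "2 * j"] m by simp_all
    have "?p \<otimes> s \<otimes> (t \<otimes> ?p) = ?p \<otimes> (s \<otimes> t) \<otimes> ?p"
      using s t p by (simp add: m_assoc)
    also have "\<dots> = (s \<otimes> t) [^] (Suc j + j)"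
      using nat_pow_mult[OF st(1), of "Suc j" j] by simp
    finally have *: "?p \<otimes> s \<otimes> (t \<otimes> ?p) = \<one>" using one m by (simp add: mult_2)
    have "inv (t \<otimes> ?p) = (t \<otimes> s) [^] j \<otimes> t"
      using s t p inv_pow by (simp add: inv_mult_group)
    also have "\<dots> = t \<otimes> ?p"
      using alternating_Suc_right[OF s t, of "2 * j"] alternating_even[OF t s, of j] lhs m by simp
    finally have "inv (t \<otimes> ?p) = t \<otimes> ?p" .
    moreover have "inv (t \<otimes> ?p) = ?p \<otimes> s"
      using * s t p by (intro inv_equality) auto
    ultimately show ?thesis using lhs rhs by simp
  qed
qed

end

subsection \<open>The root basis and its cone\<close>

context geometric_representation
begin

lemma B_add_left [simp]: "B (x + y) z = B x z + B y z"
  and B_add_right [simp]: "B z (x + y) = B z x + B z y"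
  and B_scale_left [simp]: "B (c *\<^sub>R x) z = c * B x z"
  and B_scale_right [simp]: "B z (c *\<^sub>R x) = c * B z x"
  and B_diff_left [simp]: "B (x - y) z = B x z - B y z"
  and B_diff_right [simp]: "B z (x - y) = B z x - B z y"
  and B_minus_left [simp]: "B (- x) z = - B x z"
  and B_minus_right [simp]: "B z (- x) = - B z x"
  and B_zero_left [simp]: "B 0 z = 0"
  and B_zero_right [simp]: "B z 0 = 0"
  using form_bilinear
  by (simp_all add: bilinear_ladd bilinear_radd bilinear_lmul bilinear_rmul bilinear_lsub
      bilinear_rsub bilinear_lneg bilinear_rneg bilinear_lzero bilinear_rzero)

lemma B_sum_left: "B (\<Sum>i\<in>F. f i) z = (\<Sum>i\<in>F. B (f i) z)"
  by (induction F rule: infinite_finite_induct) auto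

lemma rho_mult: "x \<in> carrier W \<Longrightarrow> y \<in> carrier W \<Longrightarrow> \<rho> (x \<otimes> y) v = \<rho> x (\<rho> y v)"
  using composition_rule by simp

lemma rho_one [simp]: "\<rho> \<one> v = v"
  using id_eq_one by (metis UNIV_I restrict_apply')

lemma rho_inv_left [simp]: "x \<in> carrier W \<Longrightarrow> \<rho> (inv x) (\<rho> x v) = v"
  by (metis inv_closed l_inv rho_mult rho_one)

lemma rho_inv_right [simp]: "x \<in> carrier W \<Longrightarrow> \<rho> x (\<rho> (inv x) v) = v"
  by (metis inv_closed r_inv rho_mult rho_one)

lemma rho_eq_iff: "w \<in> carrier W \<Longrightarrow> \<rho> w x = \<rho> w y \<longleftrightarrow> x = y"
  by (metis rho_inv_left)

lemma rho_gen: "s \<in> S \<Longrightarrow> \<rho> s v = v - (2 * B v (\<alpha> s)) *\<^sub>R \<alpha> s"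
  by (simp add: rep_gens reflection_def simple_norm)

lemma rho_gen_simple [simp]: "s \<in> S \<Longrightarrow> \<rho> s (\<alpha> s) = - \<alpha> s"
  by (simp add: rho_gen simple_norm scaleR_2)

lemma carrier_gen_induct [consumes 1, case_names one step]:
  assumes "w \<in> carrier W" "P \<one>"
    and "\<And>s v. s \<in> S \<Longrightarrow> v \<in> carrier W \<Longrightarrow> P v \<Longrightarrow> P (s \<otimes> v)"
  shows "P w"
proof -
  obtain u where "u \<in> lists S" "word_value W u = w" using word_exists[OF assms(1)] by blast
  moreover have "P (word_value W u)" if "u \<in> lists S" for u
    using that
  proof induction
    case (Cons s u)
    then show ?case using assms(3)[of s "word_value W u"] word_value_closed[of u] by auto
  qed (simp add: assms)
  ultimately show ?thesis by blast
qed

lemma rho_linear: "w \<in> carrier W \<Longrightarrow> linear (\<rho> w)"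
proof (induction rule: carrier_gen_induct)
  case one
  have "\<rho> \<one> = id" by auto
  then show ?case by (simp add: linear_id[unfolded id_def] id_def)
next
  case (step s v)
  then have "\<rho> (s \<otimes> v) = \<rho> s \<circ> \<rho> v" by (auto simp: rho_mult)
  moreover have "linear (\<rho> s)"
    using step by (intro linearI) (simp_all add: rho_gen algebra_simps)
  ultimately show ?case using step by (simp add: linear_compose[unfolded comp_def] comp_def)
qed

lemma rho_add [simp]: "w \<in> carrier W \<Longrightarrow> \<rho> w (x + y) = \<rho> w x + \<rho> w y"
  and rho_diff [simp]: "w \<in> carrier W \<Longrightarrow> \<rho> w (x - y) = \<rho> w x - \<rho> w y"
  and rho_minus [simp]: "w \<in> carrier W \<Longrightarrow> \<rho> w (- x) = - \<rho> w x"
  and rho_scale [simp]: "w \<in> carrier W \<Longrightarrow> \<rho> w (c *\<^sub>R x) = c *\<^sub>R \<rho> w x"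
  and rho_zero [simp]: "w \<in> carrier W \<Longrightarrow> \<rho> w 0 = 0"
  using rho_linear[of w]
  by (simp_all add: linear_add linear_diff linear_neg linear_cmul linear_0)

lemma B_invariant: "w \<in> carrier W \<Longrightarrow> B (\<rho> w x) (\<rho> w y) = B x y"
proof (induction arbitrary: x y rule: carrier_gen_induct)
  case (step s v)
  have "B (\<rho> s x) (\<rho> s y) = B x y" for x y
    using step(1) form_symmetric[of "\<alpha> s" y]
    by (simp add: rho_gen simple_norm algebra_simps)
  then show ?case using step by (simp add: rho_mult)
qed simp

abbreviation cone :: "'v set" where
  "cone \<equiv> convex_cone hull simple_roots"

lemma cone_add: "x \<in> cone \<Longrightarrow> y \<in> cone \<Longrightarrow> x + y \<in> cone"
  by (rule convex_cone_hull_add)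

lemma cone_scale: "x \<in> cone \<Longrightarrow> 0 \<le> c \<Longrightarrow> c *\<^sub>R x \<in> cone"
  by (rule convex_cone_hull_mul)

lemma simple_in_cone: "s \<in> S \<Longrightarrow> \<alpha> s \<in> cone"
  by (simp add: simple_roots_def hull_inc)

lemma cone_coefficients:
  assumes "x \<in> cone"
  shows "\<exists>F c. finite F \<and> F \<subseteq> S \<and> (\<forall>s. 0 \<le> c s) \<and> (\<forall>s. s \<notin> F \<longrightarrow> c s = 0) \<and>
    x = (\<Sum>s\<in>F. c s *\<^sub>R \<alpha> s)"
proof -
  define K where "K = {x. \<exists>F c. finite F \<and> F \<subseteq> S \<and> (\<forall>s. 0 \<le> c s) \<and> (\<forall>s. s \<notin> F \<longrightarrow> c s = 0) \<and>
    x = (\<Sum>s\<in>F. c s *\<^sub>R \<alpha> s)}"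
  have add: "x + y \<in> K" if x: "x \<in> K" and y: "y \<in> K" for x y
  proof -
    obtain F c where F: "finite F" "F \<subseteq> S" "\<forall>s. 0 \<le> c s" "\<forall>s. s \<notin> F \<longrightarrow> c s = 0"
      "x = (\<Sum>s\<in>F. c s *\<^sub>R \<alpha> s)" using x unfolding K_def by blast
    obtain G d where G: "finite G" "G \<subseteq> S" "\<forall>s. 0 \<le> d s" "\<forall>s. s \<notin> G \<longrightarrow> d s = 0"
      "y = (\<Sum>s\<in>G. d s *\<^sub>R \<alpha> s)" using y unfolding K_def by blast
    have "x = (\<Sum>s\<in>F \<union> G. c s *\<^sub>R \<alpha> s)" "y = (\<Sum>s\<in>F \<union> G. d s *\<^sub>R \<alpha> s)"
      using F G by (auto intro!: sum.mono_neutral_left)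
    then have "x + y = (\<Sum>s\<in>F \<union> G. (c s + d s) *\<^sub>R \<alpha> s)"
      by (simp add: sum.distrib scaleR_add_left)
    then show ?thesis unfolding K_def
      using F G by (intro CollectI exI[of _ "F \<union> G"] exI[of _ "\<lambda>s. c s + d s"]) auto
  qed
  have scale: "k *\<^sub>R x \<in> K" if x: "x \<in> K" and k: "0 \<le> k" for x k
  proof -
    obtain F c where F: "finite F" "F \<subseteq> S" "\<forall>s. 0 \<le> c s" "\<forall>s. s \<notin> F \<longrightarrow> c s = 0"
      "x = (\<Sum>s\<in>F. c s *\<^sub>R \<alpha> s)" using x unfolding K_def by blast
    then show ?thesis unfolding K_def
      using k
      by (intro CollectI exI[of _ F] exI[of _ "\<lambda>s. k * c s"]) (auto simp: scaleR_sum_right)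
  qed
  have "0 \<in> K" unfolding K_def
    by (intro CollectI exI[of _ "{}"] exI[of _ "\<lambda>_. 0"]) auto
  then have "convex_cone K"
    unfolding convex_cone_def
    by (auto simp: convex_def conic_def intro!: add scale)
  moreover have "simple_roots \<subseteq> K"
  proof
    fix v assume "v \<in> simple_roots"
    then obtain s where "s \<in> S" "v = \<alpha> s" by (auto simp: simple_roots_def)
    then show "v \<in> K" unfolding K_def
      by (intro CollectI exI[of _ "{s}"] exI[of _ "\<lambda>t. if t = s then 1 else 0"]) auto
  qed
  ultimately have "cone \<subseteq> K" by (simp add: hull_minimal)
  then show ?thesis using assms unfolding K_def by blast
qed

lemma cone_coefficients2:
  assumes "x \<in> cone" "y \<in> cone"
  shows "\<exists>F c d. finite F \<and> F \<subseteq> S \<and> (\<forall>s. 0 \<le> c s) \<and> (\<forall>s. 0 \<le> d s) \<and>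
    x = (\<Sum>s\<in>F. c s *\<^sub>R \<alpha> s) \<and> y = (\<Sum>s\<in>F. d s *\<^sub>R \<alpha> s)"
proof -
  obtain F c where F: "finite F" "F \<subseteq> S" "\<forall>s. 0 \<le> c s" "\<forall>s. s \<notin> F \<longrightarrow> c s = 0"
    "x = (\<Sum>s\<in>F. c s *\<^sub>R \<alpha> s)" using cone_coefficients[OF assms(1)] by blast
  obtain G d where G: "finite G" "G \<subseteq> S" "\<forall>s. 0 \<le> d s" "\<forall>s. s \<notin> G \<longrightarrow> d s = 0"
    "y = (\<Sum>s\<in>G. d s *\<^sub>R \<alpha> s)" using cone_coefficients[OF assms(2)] by blast
  have "x = (\<Sum>s\<in>F \<union> G. c s *\<^sub>R \<alpha> s)" "y = (\<Sum>s\<in>F \<union> G. d s *\<^sub>R \<alpha> s)"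
    using F G by (auto intro!: sum.mono_neutral_left)
  then show ?thesis
    using F G by (intro exI[of _ "F \<union> G"] exI[of _ c] exI[of _ d]) auto
qed

lemma cone_pointed:
  assumes "x \<in> cone" "- x \<in> cone"
  shows "x = 0"
proof -
  obtain F c d where *: "finite F" "F \<subseteq> S" "\<forall>s. 0 \<le> c s" "\<forall>s. 0 \<le> d s"
    "x = (\<Sum>s\<in>F. c s *\<^sub>R \<alpha> s)" "- x = (\<Sum>s\<in>F. d s *\<^sub>R \<alpha> s)"
    using cone_coefficients2[OF assms] by blast
  then have "(\<Sum>s\<in>F. (c s + d s) *\<^sub>R \<alpha> s) = 0"
    by (simp add: sum.distrib scaleR_add_left flip: *(5,6))
  then have "c s + d s = 0" if "s \<in> F" for s
    using simple_pos_independent[of F "\<lambda>s. c s + d s" s] * that by simp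
  then have "c s = 0" if "s \<in> F" for s
    using *(3,4) that by (metis add_nonneg_eq_0_iff)
  then show ?thesis using * by simp
qed

lemma simple_form_nonpos:
  assumes "s \<in> S" "t \<in> S" "s \<noteq> t"
  shows "B (\<alpha> s) (\<alpha> t) \<le> 0"
proof (cases "ord (s \<otimes> t) = 0")
  case True
  then show ?thesis using simple_infinite[OF assms] by simp
next
  case False
  have "s \<otimes> t \<noteq> \<one>"
    using assms by (metis gens_closed gens_inv inv_equality)
  then have "ord (s \<otimes> t) \<noteq> 1" using assms ord_eq_1 by simp
  then have "real (ord (s \<otimes> t)) \<ge> 2" using False by linarith
  then have "pi / real (ord (s \<otimes> t)) \<le> pi / 2" "0 \<le> pi / real (ord (s \<otimes> t))"
    by (auto simp: field_simps)
  then have "cos (pi / real (ord (s \<otimes> t))) \<ge> 0"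
    using pi_gt_zero by (intro cos_ge_zero) linarith+
  then show ?thesis using simple_finite[OF assms False] by simp
qed

lemma simple_extremal:
  assumes s: "s \<in> S" and xy: "x \<in> cone" "y \<in> cone" "x + y = k *\<^sub>R \<alpha> s"
  obtains p where "0 \<le> p" "x = p *\<^sub>R \<alpha> s"
proof -
  obtain F c d where *: "finite F" "F \<subseteq> S" "\<forall>t. 0 \<le> c t" "\<forall>t. 0 \<le> d t"
    "x = (\<Sum>t\<in>F. c t *\<^sub>R \<alpha> t)" "y = (\<Sum>t\<in>F. d t *\<^sub>R \<alpha> t)"
    using cone_coefficients2[OF xy(1,2)] by blast
  define e where "e t = (if t \<in> F then c t + d t else 0)" for t
  define G where "G = insert s F"
  have G: "finite G" "G \<subseteq> S" "s \<in> G" using * s by (auto simp: G_def)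
  have "x + y = (\<Sum>t\<in>F. e t *\<^sub>R \<alpha> t)"
    using * by (simp add: e_def sum.distrib scaleR_add_left)
  also have "\<dots> = (\<Sum>t\<in>G. e t *\<^sub>R \<alpha> t)"
    using G by (intro sum.mono_neutral_left) (auto simp: e_def G_def)
  also have "\<dots> = e s *\<^sub>R \<alpha> s + (\<Sum>t\<in>G - {s}. e t *\<^sub>R \<alpha> t)"
    using G by (simp add: sum.remove)
  finally have sum_eq: "(\<Sum>t\<in>G - {s}. e t *\<^sub>R \<alpha> t) = (k - e s) *\<^sub>R \<alpha> s"
    using xy(3) by (simp add: algebra_simps)
  have e_nonneg: "0 \<le> e t" for t using * by (simp add: e_def)
  have "k - e s = B (\<Sum>t\<in>G - {s}. e t *\<^sub>R \<alpha> t) (\<alpha> s)"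
    using s by (simp add: sum_eq simple_norm)
  also have "\<dots> \<le> 0"
    unfolding B_sum_left using G s e_nonneg simple_form_nonpos
    by (intro sum_nonpos) (auto simp: mult_nonneg_nonpos)
  finally have ks: "k \<le> e s" by simp
  have "(\<Sum>t\<in>G. (if t = s then e s - k else e t) *\<^sub>R \<alpha> t) =
      (e s - k) *\<^sub>R \<alpha> s + (\<Sum>t\<in>G - {s}. e t *\<^sub>R \<alpha> t)"
    using G by (subst sum.remove[of _ s]) (auto intro!: sum.cong)
  also have "\<dots> = 0" by (simp add: sum_eq algebra_simps)
  finally have "e t = 0" if "t \<in> G" "t \<noteq> s" for t
    using simple_pos_independent[of G "\<lambda>t. if t = s then e s - k else e t" t] G ks e_nonneg that
    by auto
  then have "c t = 0" if "t \<in> F - {s}" for t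
    using *(3,4) that by (auto simp: e_def G_def add_nonneg_eq_0_iff)
  then have "(\<Sum>t\<in>F - {s}. c t *\<^sub>R \<alpha> t) = 0" by simp
  then have "x = (if s \<in> F then c s else 0) *\<^sub>R \<alpha> s"
    using * by (auto simp: sum.remove)
  then show ?thesis using that[of "if s \<in> F then c s else 0"] * by simp
qed

end

subsection \<open>Positivity of roots\<close>

text \<open>Chebyshev polynomials of the second kind, with \<open>U\<^sub>-\<^sub>1 = 0\<close> shifted to index \<open>0\<close>.\<close>

fun chebyshev_U :: "real \<Rightarrow> nat \<Rightarrow> real" where
  "chebyshev_U c 0 = 0"
| "chebyshev_U c (Suc 0) = 1"
| "chebyshev_U c (Suc (Suc k)) = 2 * c * chebyshev_U c (Suc k) - chebyshev_U c k"

lemma chebyshev_U_nonneg: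
  assumes "1 \<le> c"
  shows "0 \<le> chebyshev_U c k"
proof -
  have "0 \<le> chebyshev_U c k \<and> chebyshev_U c k \<le> chebyshev_U c (Suc k)"
  proof (induction k)
    case (Suc k)
    have "chebyshev_U c (Suc k) \<le> c * chebyshev_U c (Suc k)"
      using assms Suc mult_right_mono[of 1 c "chebyshev_U c (Suc k)"] by simp
    then show ?case using Suc by simp
  qed simp
  then show ?thesis by blast
qed

lemma chebyshev_U_cos: "chebyshev_U (cos x) k * sin x = sin (real k * x)"
proof (induction k rule: induct_nat_012)
  case (ge2 k)
  have "sin (real (Suc (Suc k)) * x) + sin (real k * x) = 2 * cos x * sin (real (Suc k) * x)"
    using sin_plus_sin[of "real (Suc (Suc k)) * x" "real k * x"]
    by (simp add: algebra_simps add_divide_distrib diff_divide_distrib)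
  then show ?case using ge2 by (simp add: algebra_simps)
qed auto

context geometric_representation
begin

lemma alternating_action:
  assumes "s \<in> S" "t \<in> S" "c = - B (\<alpha> s) (\<alpha> t)"
  shows "\<rho> (alternating s t k) (\<alpha> s) =
    (if even k then chebyshev_U c (Suc k) *\<^sub>R \<alpha> s + chebyshev_U c k *\<^sub>R \<alpha> t
     else chebyshev_U c k *\<^sub>R \<alpha> s + chebyshev_U c (Suc k) *\<^sub>R \<alpha> t)"
proof (induction k)
  case (Suc k)
  have "B (\<alpha> t) (\<alpha> s) = - c" "B (\<alpha> s) (\<alpha> t) = - c"
    using assms form_symmetric[of "\<alpha> t" "\<alpha> s"] by simp_all
  then show ?case
    using Suc assms(1,2)
    by (simp add: rho_mult rho_gen simple_norm algebra_simps del: chebyshev_U.simps)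
       (simp flip: scaleR_add_left)
qed simp

lemma alternating_action_pos:
  assumes s: "s \<in> S" and t: "t \<in> S" and st: "s \<noteq> t"
    and k: "ord (s \<otimes> t) \<noteq> 0 \<Longrightarrow> k < ord (s \<otimes> t)"
  obtains p q where "0 \<le> p" "0 \<le> q" "\<rho> (alternating s t k) (\<alpha> s) = p *\<^sub>R \<alpha> s + q *\<^sub>R \<alpha> t"
proof -
  define c where "c = - B (\<alpha> s) (\<alpha> t)"
  have "0 \<le> chebyshev_U c j" if j: "j \<le> Suc k" for j
  proof (cases "ord (s \<otimes> t) = 0")
    case True
    then show ?thesis
      using simple_infinite[OF s t st] by (intro chebyshev_U_nonneg) (simp add: c_def)
  next
    case False
    define m where "m = ord (s \<otimes> t)"
    have "s \<otimes> t \<noteq> \<one>"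
      using s t st by (metis gens_closed gens_inv inv_equality)
    then have "m \<noteq> 1" using s t ord_eq_1 by (simp add: m_def)
    then have m: "2 \<le> m" using False by (simp add: m_def)
    have c: "c = cos (pi / m)" using simple_finite[OF s t st False] by (simp add: c_def m_def)
    have "pi / m < pi" using m by (simp add: field_simps)
    then have sin_pos: "0 < sin (pi / m)" using m by (intro sin_gt_zero) auto
    have "real j \<le> real m" using j k False by (simp add: m_def)
    then have "real j * (pi / m) \<le> pi" using m by (simp add: field_simps)
    then have "0 \<le> sin (real j * (pi / m))" by (intro sin_ge_zero) auto
    then show ?thesis
      using chebyshev_U_cos[of "pi / m" j] sin_pos c
        zero_le_mult_iff[of "chebyshev_U c j" "sin (pi / m)"] by simp
  qed
  then have U: "0 \<le> chebyshev_U c k" "0 \<le> chebyshev_U c (Suc k)" by auto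
  show ?thesis
    using alternating_action[OF s t c_def, of k] U that by (cases "even k") auto
qed

text \<open>Strip a maximal alternating suffix in \<open>s\<close> and \<open>t\<close> from \<open>w\<close>: what remains is minimal in its
  coset of the dihedral group generated by \<open>s\<close> and \<open>t\<close>, so induction applies to both letters.\<close>

theorem ascent_positive:
  assumes "w \<in> carrier W" "s \<in> S" "len (w \<otimes> s) = len w + 1"
  shows "\<rho> w (\<alpha> s) \<in> cone"
  using assms
proof (induction "len w" arbitrary: w s rule: less_induct)
  case less
  note w = \<open>w \<in> carrier W\<close> and s = \<open>s \<in> S\<close>
  show ?case
  proof (cases "w = \<one>")
    case True
    then show ?thesis using s simple_in_cone by simp
  next
    case False
    then obtain t where t: "t \<in> S" "len w = len (w \<otimes> t) + 1"
      using right_descent_exists[OF w] by blast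
    have st: "s \<noteq> t" using t less.prems by auto
    define v where "v k = w \<otimes> inv (alternating s t k)" for k
    have v_closed: "v k \<in> carrier W" for k using w s t by (simp add: v_def)
    have w_eq: "w = v k \<otimes> alternating s t k" for k using w s t by (simp add: v_def m_assoc)
    have v_Suc: "v (Suc k) = v k \<otimes> (if even k then t else s)" for k
      using w s t by (simp add: v_def inv_mult_group m_assoc)
    define Q where "Q k \<longleftrightarrow> len (v k) + k = len w" for k
    have "\<not> Q (Suc (len w))" by (simp add: Q_def)
    define K where "K = (LEAST k. \<not> Q k)"
    have notQ: "\<not> Q K" unfolding K_def by (rule LeastI) fact
    have Q: "Q k" if "k < K" for k using not_less_Least that unfolding K_def by blast
    have Q01: "Q 0" "Q 1" using w s t by (auto simp: Q_def v_def)
    then have "K \<noteq> 0" "K \<noteq> 1" using notQ by metis+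
    then obtain k where k: "K = Suc (Suc k)" by (metis One_nat_def not0_implies_Suc)
    let ?r = "if even (Suc k) then t else s" and ?r' = "if even k then t else s"
    have r: "?r \<in> S" "?r' \<in> S" using s t by auto
    have Qk: "len (v k) + k = len w" "len (v (Suc k)) + Suc k = len w"
      using Q[of k] Q[of "Suc k"] k by (auto simp: Q_def)
    have "len (v (Suc k) \<otimes> ?r) \<noteq> len (v (Suc k)) - 1 \<or> len (v (Suc k)) = 0"
      using notQ k Qk v_Suc[of "Suc k"] by (auto simp: Q_def)
    then have up: "len (v (Suc k) \<otimes> ?r) = len (v (Suc k)) + 1"
      using len_mult_gen[OF v_closed r(1), of "Suc k"] by auto
    have "v (Suc k) \<otimes> ?r' = v k"
      using v_Suc[of k] r(2) v_closed by simp
    then have up': "len (v (Suc k) \<otimes> ?r') = len (v (Suc k)) + 1"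
      using Qk by simp
    have less_w: "len (v (Suc k)) < len w" using Qk by simp
    have both: "\<rho> (v (Suc k)) (\<alpha> s) \<in> cone" "\<rho> (v (Suc k)) (\<alpha> t) \<in> cone"
      using less.hyps[OF less_w v_closed r(1) up] less.hyps[OF less_w v_closed r(2) up']
      by (auto split: if_splits)
    have "Suc k < ord (s \<otimes> t)" if fin: "ord (s \<otimes> t) \<noteq> 0"
    proof (rule ccontr)
      assume "\<not> Suc k < ord (s \<otimes> t)"
      then obtain j where j: "ord (s \<otimes> t) = Suc j" "Suc j \<le> Suc k"
        using fin by (metis not0_implies_Suc not_less)
      have "alternating s t (Suc j) = alternating t s (Suc j)"
        using alternating_braid[OF s t(1), of "Suc j"] pow_ord_eq_1[of "s \<otimes> t"] s t
        unfolding j(1) by simp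
      also have "\<dots> = alternating s t j \<otimes> s"
        using alternating_Suc_right[OF t(1) s] .
      finally have "w \<otimes> s = v (Suc j) \<otimes> alternating s t j"
        using w_eq[of "Suc j"] s t v_closed[of "Suc j"] by (simp add: m_assoc[symmetric] del: alternating.simps)
      then have "len (w \<otimes> s) \<le> len (v (Suc j)) + j"
        using len_mult_le[of "v (Suc j)" "alternating s t j"] len_alternating_le[OF s t(1), of j]
          v_closed s t by fastforce
      moreover have "len (v (Suc j)) + Suc j = len w" using Q[of "Suc j"] j k by (simp add: Q_def)
      ultimately show False using less.prems by simp
    qed
    then obtain p q where pq: "0 \<le> p" "0 \<le> q"
      "\<rho> (alternating s t (Suc k)) (\<alpha> s) = p *\<^sub>R \<alpha> s + q *\<^sub>R \<alpha> t"
      using alternating_action_pos[OF s t(1) st, of "Suc k"] by blast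
    have "\<rho> w (\<alpha> s) = \<rho> (v (Suc k)) (\<rho> (alternating s t (Suc k)) (\<alpha> s))"
      using rho_mult[OF v_closed alternating_closed[OF s t(1)]] w_eq[of "Suc k"] by metis
    also have "\<dots> = p *\<^sub>R \<rho> (v (Suc k)) (\<alpha> s) + q *\<^sub>R \<rho> (v (Suc k)) (\<alpha> t)"
      unfolding pq(3) using v_closed by simp
    also have "\<dots> \<in> cone" using both pq by (intro cone_add cone_scale)
    finally show ?thesis .
  qed
qed

lemma descent_negative:
  assumes "w \<in> carrier W" "s \<in> S" "len w = len (w \<otimes> s) + 1"
  shows "- \<rho> w (\<alpha> s) \<in> cone"
  using ascent_positive[of "w \<otimes> s" s] assms by (simp add: rho_mult)

end

subsection \<open>Roots, reflections and inversions\<close>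

context geometric_representation
begin

lemma root_rho: "\<beta> \<in> roots \<Longrightarrow> w \<in> carrier W \<Longrightarrow> \<rho> w \<beta> \<in> roots"
proof -
  assume "\<beta> \<in> roots" and w: "w \<in> carrier W"
  then obtain v s where "v \<in> carrier W" "s \<in> S" "\<beta> = \<rho> v (\<alpha> s)"
    by (auto simp: roots_def simple_roots_def)
  then have "\<rho> w \<beta> = \<rho> (w \<otimes> v) (\<alpha> s)" "w \<otimes> v \<in> carrier W" "s \<in> S"
    using w by (auto simp: rho_mult)
  then show ?thesis unfolding roots_def simple_roots_def by blast
qed

lemma simple_root: "s \<in> S \<Longrightarrow> \<alpha> s \<in> roots"
  unfolding roots_def simple_roots_def by (metis UN_I imageI one_closed rho_one)

lemma rootE:
  assumes "\<beta> \<in> roots"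
  obtains w s where "w \<in> carrier W" "s \<in> S" "\<beta> = \<rho> w (\<alpha> s)"
  using assms by (auto simp: roots_def simple_roots_def)

lemma root_minus: "\<beta> \<in> roots \<Longrightarrow> - \<beta> \<in> roots"
proof (erule rootE)
  fix w s assume "w \<in> carrier W" "s \<in> S" "\<beta> = \<rho> w (\<alpha> s)"
  then have "- \<beta> = \<rho> w (\<rho> s (\<alpha> s))" by simp
  then show "- \<beta> \<in> roots"
    using \<open>w \<in> carrier W\<close> \<open>s \<in> S\<close> by (simp only: root_rho simple_root gens_closed)
qed

lemma root_norm [simp]: "\<beta> \<in> roots \<Longrightarrow> B \<beta> \<beta> = 1"
  by (erule rootE) (simp add: B_invariant simple_norm)

lemma root_nonzero: "\<beta> \<in> roots \<Longrightarrow> \<beta> \<noteq> 0"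
  using root_norm by fastforce

lemma pos_roots_iff: "\<beta> \<in> pos_roots \<longleftrightarrow> \<beta> \<in> roots \<and> \<beta> \<in> cone"
  by (simp add: pos_roots_def)

lemma pos_root [simp]: "\<beta> \<in> pos_roots \<Longrightarrow> \<beta> \<in> roots"
  by (simp add: pos_roots_def)

lemma simple_pos: "s \<in> S \<Longrightarrow> \<alpha> s \<in> pos_roots"
  by (simp add: pos_roots_iff simple_root simple_in_cone)

lemma root_pos_or_neg:
  assumes "\<beta> \<in> roots"
  shows "\<beta> \<in> pos_roots \<or> - \<beta> \<in> pos_roots"
proof -
  obtain w s where "w \<in> carrier W" "s \<in> S" "\<beta> = \<rho> w (\<alpha> s)" using assms by (rule rootE)
  then have "\<beta> \<in> cone \<or> - \<beta> \<in> cone"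
    using ascent_positive[of w s] descent_negative[of w s] len_mult_gen[of w s] by auto
  then show ?thesis using assms root_minus by (auto simp: pos_roots_iff)
qed

lemma pos_not_neg: "\<beta> \<in> pos_roots \<Longrightarrow> - \<beta> \<notin> pos_roots"
  using cone_pointed root_nonzero by (auto simp: pos_roots_iff)

lemma not_pos_iff: "\<beta> \<in> roots \<Longrightarrow> \<beta> \<notin> pos_roots \<longleftrightarrow> - \<beta> \<in> pos_roots"
  using root_pos_or_neg pos_not_neg by blast

lemma not_neg_iff: "\<beta> \<in> roots \<Longrightarrow> - \<beta> \<notin> pos_roots \<longleftrightarrow> \<beta> \<in> pos_roots"
  using root_pos_or_neg pos_not_neg by blast

lemma root_in_cone: "\<beta> \<in> roots \<Longrightarrow> \<beta> \<in> cone \<Longrightarrow> \<beta> \<in> pos_roots"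
  by (simp add: pos_roots_iff)

lemma roots_parallel:
  assumes "\<beta> \<in> roots" "\<gamma> \<in> roots" "\<beta> = c *\<^sub>R \<gamma>"
  shows "\<beta> = \<gamma> \<or> \<beta> = - \<gamma>"
proof -
  have "c * c = 1" using assms root_norm[of \<beta>] root_norm[of \<gamma>] by simp
  then have "c = 1 \<or> c = - 1" by (simp add: square_eq_1_iff)
  then show ?thesis using assms by auto
qed

lemma pos_roots_parallel:
  "\<beta> \<in> pos_roots \<Longrightarrow> \<gamma> \<in> pos_roots \<Longrightarrow> \<beta> = c *\<^sub>R \<gamma> \<Longrightarrow> \<beta> = \<gamma>"
  using roots_parallel[of \<beta> \<gamma> c] pos_not_neg by auto

lemma rho_faithful:
  assumes "x \<in> carrier W" "\<And>v. \<rho> x v = v"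
  shows "x = \<one>"
proof (rule ccontr)
  assume "x \<noteq> \<one>"
  then obtain s where s: "s \<in> S" "len x = len (x \<otimes> s) + 1"
    using assms right_descent_exists by blast
  then have "- \<alpha> s \<in> cone" using descent_negative[of x s] assms by simp
  then show False
    using cone_pointed[of "\<alpha> s"] simple_in_cone s simple_root root_nonzero by blast
qed

lemma rho_inject:
  assumes "x \<in> carrier W" "y \<in> carrier W" "\<And>v. \<rho> x v = \<rho> y v"
  shows "x = y"
proof -
  have "inv y \<otimes> x = \<one>" using assms by (intro rho_faithful) (auto simp: rho_mult)
  then show ?thesis using assms by (metis inv_closed inv_equality inv_inv)
qed

lemma refl_unique:
  assumes "x \<in> carrier W" "\<beta> \<in> roots" "\<And>v. \<rho> x v = v - (2 * B v \<beta>) *\<^sub>R \<beta>"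
  shows "refl \<beta> = x"
  unfolding refl_def
proof (rule the_equality)
  show "x \<in> carrier W \<and> \<rho> x = reflection B \<beta>"
    using assms by (auto simp: reflection_def)
  show "y = x" if "y \<in> carrier W \<and> \<rho> y = reflection B \<beta>" for y
    using that assms by (intro rho_inject) (auto simp: reflection_def)
qed

lemma refl_rho_simple:
  assumes "w \<in> carrier W" "s \<in> S"
  shows "refl (\<rho> w (\<alpha> s)) = w \<otimes> s \<otimes> inv w"
proof (rule refl_unique)
  fix v
  have "B (\<rho> (inv w) v) (\<alpha> s) = B v (\<rho> w (\<alpha> s))"
    using B_invariant[of w "\<rho> (inv w) v" "\<alpha> s"] assms by simp
  then show "\<rho> (w \<otimes> s \<otimes> inv w) v = v - (2 * B v (\<rho> w (\<alpha> s))) *\<^sub>R \<rho> w (\<alpha> s)"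
    using assms by (simp add: rho_mult rho_gen)
qed (use assms in \<open>auto intro: root_rho simple_root\<close>)

lemma refl_closed [simp]: "\<beta> \<in> roots \<Longrightarrow> refl \<beta> \<in> carrier W"
  by (erule rootE) (simp add: refl_rho_simple)

lemma rho_refl: "\<beta> \<in> roots \<Longrightarrow> \<rho> (refl \<beta>) v = v - (2 * B v \<beta>) *\<^sub>R \<beta>"
proof (erule rootE)
  fix w s assume *: "w \<in> carrier W" "s \<in> S" "\<beta> = \<rho> w (\<alpha> s)"
  have "B (\<rho> (inv w) v) (\<alpha> s) = B v (\<rho> w (\<alpha> s))"
    using B_invariant[of w "\<rho> (inv w) v" "\<alpha> s"] * by simp
  then show "\<rho> (refl \<beta>) v = v - (2 * B v \<beta>) *\<^sub>R \<beta>"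
    using * by (simp add: refl_rho_simple rho_mult rho_gen)
qed

lemma rho_refl_self [simp]: "\<beta> \<in> roots \<Longrightarrow> \<rho> (refl \<beta>) \<beta> = - \<beta>"
  by (simp add: rho_refl scaleR_2)

lemma rho_refl_refl [simp]: "\<beta> \<in> roots \<Longrightarrow> \<rho> (refl \<beta>) (\<rho> (refl \<beta>) v) = v"
  by (simp add: rho_refl algebra_simps)

lemma refl_square [simp]: "\<beta> \<in> roots \<Longrightarrow> refl \<beta> \<otimes> refl \<beta> = \<one>"
  by (rule rho_faithful) (simp_all add: rho_mult)

lemma refl_inv [simp]: "\<beta> \<in> roots \<Longrightarrow> inv (refl \<beta>) = refl \<beta>"
  by (simp add: inv_equality)

lemma refl_cancel [simp]: "\<beta> \<in> roots \<Longrightarrow> x \<in> carrier W \<Longrightarrow> refl \<beta> \<otimes> (refl \<beta> \<otimes> x) = x"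
  by (simp flip: m_assoc)

lemma refl_simple [simp]: "s \<in> S \<Longrightarrow> refl (\<alpha> s) = s"
  by (rule refl_unique) (simp_all add: simple_root rho_gen)

lemma refl_minus [simp]: "\<beta> \<in> roots \<Longrightarrow> refl (- \<beta>) = refl \<beta>"
  by (rule refl_unique) (simp_all add: root_minus rho_refl)

lemma refl_rho:
  assumes "w \<in> carrier W" "\<beta> \<in> roots"
  shows "refl (\<rho> w \<beta>) = w \<otimes> refl \<beta> \<otimes> inv w"
proof (rule refl_unique)
  fix v
  have "B (\<rho> (inv w) v) \<beta> = B v (\<rho> w \<beta>)"
    using B_invariant[of w "\<rho> (inv w) v" \<beta>] assms by simp
  then show "\<rho> (w \<otimes> refl \<beta> \<otimes> inv w) v = v - (2 * B v (\<rho> w \<beta>)) *\<^sub>R \<rho> w \<beta>"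
    using assms by (simp add: rho_mult rho_refl)
qed (use assms in \<open>auto intro: root_rho\<close>)

lemma refl_eq_imp:
  assumes "\<beta> \<in> roots" "\<gamma> \<in> roots" "refl \<beta> = refl \<gamma>"
  shows "\<beta> = \<gamma> \<or> \<beta> = - \<gamma>"
proof -
  have "- \<beta> = \<beta> - (2 * B \<beta> \<gamma>) *\<^sub>R \<gamma>"
    using assms by (metis rho_refl rho_refl_self)
  then have "2 *\<^sub>R \<beta> = 2 *\<^sub>R (B \<beta> \<gamma> *\<^sub>R \<gamma>)"
    by (simp add: scaleR_2 algebra_simps)
  then have "\<beta> = B \<beta> \<gamma> *\<^sub>R \<gamma>"
    by (metis scaleR_cancel_left zero_neq_numeral)
  then show ?thesis using roots_parallel assms by blast
qed

lemma inversions_iff: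
  assumes "w \<in> carrier W"
  shows "\<beta> \<in> inversions w \<longleftrightarrow> \<beta> \<in> pos_roots \<and> - \<rho> (inv w) \<beta> \<in> pos_roots"
proof -
  have "\<beta> \<in> \<rho> w ` neg_roots \<longleftrightarrow> - \<rho> (inv w) \<beta> \<in> pos_roots"
  proof
    assume "\<beta> \<in> \<rho> w ` neg_roots"
    then show "- \<rho> (inv w) \<beta> \<in> pos_roots" using assms by (auto simp: neg_roots_def)
  next
    assume *: "- \<rho> (inv w) \<beta> \<in> pos_roots"
    have "\<beta> = \<rho> w (- (- \<rho> (inv w) \<beta>))" using assms by simp
    then show "\<beta> \<in> \<rho> w ` neg_roots" unfolding neg_roots_def using * by blast
  qed
  then show ?thesis by (auto simp: inversions_def)
qed

lemma inversions_pos: "\<beta> \<in> inversions w \<Longrightarrow> \<beta> \<in> pos_roots"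
  by (simp add: inversions_def)

lemma inversions_refl_iff:
  "\<beta> \<in> roots \<Longrightarrow> \<gamma> \<in> inversions (refl \<beta>) \<longleftrightarrow> \<gamma> \<in> pos_roots \<and> - \<rho> (refl \<beta>) \<gamma> \<in> pos_roots"
  by (simp add: inversions_iff)

lemma not_inversion:
  assumes "w \<in> carrier W" "\<beta> \<in> pos_roots" "\<beta> \<notin> inversions w"
  shows "\<rho> (inv w) \<beta> \<in> pos_roots"
  using assms not_neg_iff[of "\<rho> (inv w) \<beta>"] root_rho[of \<beta> "inv w"] by (auto simp: inversions_iff)

lemma simple_reflection_pos:
  assumes "s \<in> S" "\<beta> \<in> pos_roots" "\<beta> \<noteq> \<alpha> s"
  shows "\<rho> s \<beta> \<in> pos_roots"
proof (rule ccontr)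
  assume "\<rho> s \<beta> \<notin> pos_roots"
  then have "- \<rho> s \<beta> \<in> pos_roots"
    using root_rho[of \<beta> s] not_pos_iff[of "\<rho> s \<beta>"] assms by simp
  moreover have "\<beta> + - \<rho> s \<beta> = (2 * B \<beta> (\<alpha> s)) *\<^sub>R \<alpha> s" using assms by (simp add: rho_gen)
  ultimately obtain p where "\<beta> = p *\<^sub>R \<alpha> s"
    using simple_extremal[OF assms(1), of \<beta> "- \<rho> s \<beta>"] assms(2) by (auto simp: pos_roots_iff)
  then show False using pos_roots_parallel assms simple_pos by blast
qed

lemma inversions_one [simp]: "inversions \<one> = {}"
  using pos_not_neg by (auto simp: inversions_iff)

lemma inversions_mult_gen:
  assumes w: "w \<in> carrier W" and s: "s \<in> S" and pos: "\<rho> w (\<alpha> s) \<in> pos_roots"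
  shows "inversions (w \<otimes> s) = insert (\<rho> w (\<alpha> s)) (inversions w)"
    and "\<rho> w (\<alpha> s) \<notin> inversions w"
proof -
  show "\<rho> w (\<alpha> s) \<notin> inversions w"
    using w s simple_pos pos_not_neg by (auto simp: inversions_iff)
  show "inversions (w \<otimes> s) = insert (\<rho> w (\<alpha> s)) (inversions w)"
  proof (intro Set.set_eqI iffI)
    fix \<beta> assume *: "\<beta> \<in> inversions (w \<otimes> s)"
    show "\<beta> \<in> insert (\<rho> w (\<alpha> s)) (inversions w)"
    proof (rule ccontr)
      assume no: "\<beta> \<notin> insert (\<rho> w (\<alpha> s)) (inversions w)"
      have \<beta>: "\<beta> \<in> pos_roots" using * by (rule inversions_pos)
      then have "\<rho> (inv w) \<beta> \<in> pos_roots" using no w by (intro not_inversion) auto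
      moreover have "\<rho> (inv w) \<beta> \<noteq> \<alpha> s" using no w by (metis insertI1 rho_inv_right)
      ultimately have "\<rho> s (\<rho> (inv w) \<beta>) \<in> pos_roots" by (rule simple_reflection_pos[OF s])
      moreover have "- \<rho> s (\<rho> (inv w) \<beta>) \<in> pos_roots"
        using * w s by (simp add: inversions_iff inv_mult_group rho_mult)
      ultimately show False using pos_not_neg by blast
    qed
  next
    fix \<beta> assume *: "\<beta> \<in> insert (\<rho> w (\<alpha> s)) (inversions w)"
    show "\<beta> \<in> inversions (w \<otimes> s)"
    proof (cases "\<beta> = \<rho> w (\<alpha> s)")
      case True
      then show ?thesis
        using w s pos simple_pos by (simp add: inversions_iff inv_mult_group rho_mult)
    next
      case False
      then have "\<beta> \<in> pos_roots" "- \<rho> (inv w) \<beta> \<in> pos_roots"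
        using * w by (auto simp: inversions_iff)
      moreover have "- \<rho> (inv w) \<beta> \<noteq> \<alpha> s"
        using calculation(1) pos pos_not_neg w
        by (metis rho_inv_right rho_minus inv_closed minus_minus)
      ultimately show ?thesis
        using simple_reflection_pos[OF s, of "- \<rho> (inv w) \<beta>"] w s
        by (simp add: inversions_iff inv_mult_group rho_mult)
    qed
  qed
qed

lemma ascent_pos_root:
  assumes "w \<in> carrier W" "s \<in> S" "len (w \<otimes> s) = len w + 1"
  shows "\<rho> w (\<alpha> s) \<in> pos_roots"
  using ascent_positive assms root_rho simple_root by (auto simp: pos_roots_iff)

text \<open>\<open>g\<close> lists the inversions of \<open>w\<close> in the order of a reduced word, and the \<open>v\<close> are its prefixes.\<close>

lemma inversion_chain:
  assumes "w \<in> carrier W"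
  shows "\<exists>g. inversions w = g ` {..<len w} \<and>
    (\<forall>i<len w. \<exists>v\<in>carrier W. \<exists>s\<in>S. g i = \<rho> v (\<alpha> s) \<and> g i \<in> pos_roots \<and>
      inversions v = g ` {..<i} \<and> g i \<notin> inversions v)"
  using assms
proof (induction "len w" arbitrary: w)
  case 0
  then show ?case using len_eq_0[of w] by auto
next
  case (Suc n)
  then have "w \<noteq> \<one>" by auto
  then obtain s where s: "s \<in> S" "len w = len (w \<otimes> s) + 1"
    using right_descent_exists Suc.prems by blast
  define v where "v = w \<otimes> s"
  have v: "v \<in> carrier W" "len v = n" "v \<otimes> s = w"
    using s Suc by (auto simp: v_def)
  then obtain g where g: "inversions v = g ` {..<n}"
    "\<forall>i<n. \<exists>v\<in>carrier W. \<exists>s\<in>S. g i = \<rho> v (\<alpha> s) \<and> g i \<in> pos_roots \<and>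
      inversions v = g ` {..<i} \<and> g i \<notin> inversions v"
    using Suc.hyps(1)[of v] by auto
  have pos: "\<rho> v (\<alpha> s) \<in> pos_roots"
    using v s Suc.hyps(2) by (intro ascent_pos_root) auto
  note inv = inversions_mult_gen[OF v(1) s(1) pos]
  define h where "h = g (n := \<rho> v (\<alpha> s))"
  have img: "h ` {..<i} = g ` {..<i}" if "i \<le> n" for i
    using that by (auto simp: h_def intro!: image_cong)
  have "inversions w = h ` {..<Suc n}"
    using inv(1) v(3) g(1) unfolding lessThan_Suc image_insert img[OF order_refl]
    by (simp add: h_def)
  moreover have "\<exists>v\<in>carrier W. \<exists>s\<in>S. h i = \<rho> v (\<alpha> s) \<and> h i \<in> pos_roots \<and>
      inversions v = h ` {..<i} \<and> h i \<notin> inversions v" if i: "i < Suc n" for i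
  proof (cases "i = n")
    case True
    have "h i = \<rho> v (\<alpha> s) \<and> h i \<in> pos_roots \<and> inversions v = h ` {..<i} \<and> h i \<notin> inversions v"
      using True inv(2) pos g(1) img[of n] by (simp add: h_def)
    then show ?thesis using v(1) s(1) by blast
  next
    case False
    then have "i < n" "h i = g i" using i by (auto simp: h_def)
    then show ?thesis using g(2) img[of i] by auto
  qed
  ultimately show ?case using Suc.hyps(2) by (metis (no_types, lifting))
qed

lemma inversions_finite_card:
  assumes "w \<in> carrier W"
  shows "finite (inversions w)" and "card (inversions w) = len w"
proof -
  obtain g where g: "inversions w = g ` {..<len w}"
    "\<forall>i<len w. \<exists>v\<in>carrier W. \<exists>s\<in>S. g i = \<rho> v (\<alpha> s) \<and> g i \<in> pos_roots \<and>
      inversions v = g ` {..<i} \<and> g i \<notin> inversions v"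
    using inversion_chain[OF assms] by blast
  then show "finite (inversions w)" by simp
  have "g i \<notin> g ` {..<i}" if "i < len w" for i using g(2) that by metis
  then have "inj_on g {..<len w}"
    by (intro linorder_inj_onI) (auto, metis imageI lessThan_iff)
  then show "card (inversions w) = len w" using g(1) by (simp add: card_image)
qed

end

subsection \<open>Counting inversions of a reflected element\<close>

context geometric_representation
begin

lemma combination_pos:
  assumes "\<gamma> \<in> roots" "\<gamma> = p *\<^sub>R \<beta> + q *\<^sub>R \<delta>" "\<beta> \<in> pos_roots" "\<delta> \<in> pos_roots" "0 \<le> p" "0 \<le> q"
  shows "\<gamma> \<in> pos_roots"
  using assms by (intro root_in_cone) (auto intro!: cone_add cone_scale simp: pos_roots_iff)

lemma pos_of_positive_multiple:
  assumes "\<beta> \<in> roots" "c *\<^sub>R \<beta> \<in> cone" "0 < c"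
  shows "\<beta> \<in> pos_roots"
proof -
  have "\<beta> \<in> cone" using cone_scale[OF assms(2), of "1 / c"] assms(3) by simp
  then show ?thesis using assms by (intro root_in_cone)
qed

lemma refl_partner:
  assumes "\<beta> \<in> pos_roots" "\<kappa> \<in> inversions (refl \<beta>)"
  shows "- \<rho> (refl \<beta>) \<kappa> \<in> inversions (refl \<beta>)"
    and "\<kappa> + - \<rho> (refl \<beta>) \<kappa> = (2 * B \<kappa> \<beta>) *\<^sub>R \<beta>"
    and "0 < B \<kappa> \<beta>"
proof -
  have \<beta>: "\<beta> \<in> roots" using assms by simp
  note \<kappa> = assms(2)[unfolded inversions_refl_iff[OF \<beta>]]
  show "- \<rho> (refl \<beta>) \<kappa> \<in> inversions (refl \<beta>)" using \<kappa> \<beta> by (simp add: inversions_refl_iff)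
  show sum: "\<kappa> + - \<rho> (refl \<beta>) \<kappa> = (2 * B \<kappa> \<beta>) *\<^sub>R \<beta>" using \<beta> by (simp add: rho_refl)
  show "0 < B \<kappa> \<beta>"
  proof (rule ccontr)
    assume "\<not> 0 < B \<kappa> \<beta>"
    then have "(- 2 * B \<kappa> \<beta>) *\<^sub>R \<beta> \<in> cone"
      using assms by (intro cone_scale) (auto simp: pos_roots_iff)
    moreover have "- \<kappa> = - \<rho> (refl \<beta>) \<kappa> + (- 2 * B \<kappa> \<beta>) *\<^sub>R \<beta>" using \<beta> by (simp add: rho_refl)
    ultimately have "- \<kappa> \<in> cone" using \<kappa> by (metis cone_add pos_roots_iff)
    then show False using cone_pointed[of \<kappa>] \<kappa> root_nonzero[of \<kappa>] by (auto simp: pos_roots_iff)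
  qed
qed

lemma inversion_partner:
  assumes w: "w \<in> carrier W" and \<beta>: "\<beta> \<in> inversions w" and \<kappa>: "\<kappa> \<in> inversions (refl \<beta>)"
    and not: "\<kappa> \<notin> inversions w"
  shows "- \<rho> (refl \<beta>) \<kappa> \<in> inversions w"
proof (rule ccontr)
  let ?\<mu> = "- \<rho> (refl \<beta>) \<kappa>"
  assume "?\<mu> \<notin> inversions w"
  have pos: "\<beta> \<in> pos_roots" using \<beta> by (rule inversions_pos)
  have "\<kappa> \<in> pos_roots" "?\<mu> \<in> pos_roots"
    using \<kappa> refl_partner(1)[OF pos \<kappa>] by (auto simp: inversions_def)
  then have "\<rho> (inv w) \<kappa> \<in> pos_roots" "\<rho> (inv w) ?\<mu> \<in> pos_roots"
    using not_inversion[OF w] not \<open>?\<mu> \<notin> inversions w\<close> by blast+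
  then have "\<rho> (inv w) \<kappa> + \<rho> (inv w) ?\<mu> \<in> cone" by (intro cone_add) (simp_all only: pos_roots_iff)
  then have "\<rho> (inv w) (\<kappa> + ?\<mu>) \<in> cone" using w by (simp only: rho_add inv_closed)
  then have "(2 * B \<kappa> \<beta>) *\<^sub>R \<rho> (inv w) \<beta> \<in> cone"
    unfolding refl_partner(2)[OF pos \<kappa>] using w by simp
  then have "\<rho> (inv w) \<beta> \<in> pos_roots"
    using refl_partner(3)[OF pos \<kappa>] w pos
    by (intro pos_of_positive_multiple[of _ "2 * B \<kappa> \<beta>"]) (auto intro: root_rho)
  then show False using \<beta> w pos_not_neg by (auto simp: inversions_iff)
qed

lemma refl_mult_inv: "\<beta> \<in> roots \<Longrightarrow> w \<in> carrier W \<Longrightarrow> inv (refl \<beta> \<otimes> w) = inv w \<otimes> refl \<beta>"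
  by (simp add: inv_mult_group)

lemma inversions_refl_mult_iff:
  "\<beta> \<in> roots \<Longrightarrow> w \<in> carrier W \<Longrightarrow> \<gamma> \<in> inversions (refl \<beta> \<otimes> w) \<longleftrightarrow>
    \<gamma> \<in> pos_roots \<and> - \<rho> (inv w) (\<rho> (refl \<beta>) \<gamma>) \<in> pos_roots"
  by (simp add: inversions_iff refl_mult_inv rho_mult)

definition paired_inversions :: "'w \<Rightarrow> 'v \<Rightarrow> 'v set" where
  "paired_inversions w \<beta> =
    {\<kappa> \<in> inversions (refl \<beta>) \<inter> inversions w. - \<rho> (refl \<beta>) \<kappa> \<in> inversions w}"

lemma self_inversion: "\<beta> \<in> pos_roots \<Longrightarrow> \<beta> \<in> inversions (refl \<beta>)"
  by (simp add: inversions_refl_iff)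

lemma self_paired: "\<beta> \<in> inversions w \<Longrightarrow> \<beta> \<in> paired_inversions w \<beta>"
  using self_inversion[of \<beta>] inversions_pos[of \<beta> w] by (auto simp: paired_inversions_def)

lemma paired_inversions_subset: "paired_inversions w \<beta> \<subseteq> inversions w"
  by (auto simp: paired_inversions_def)

lemma subspace_refl:
  "subspace P \<Longrightarrow> \<beta> \<in> roots \<Longrightarrow> \<beta> \<in> P \<Longrightarrow> \<rho> (refl \<beta>) x \<in> P \<longleftrightarrow> x \<in> P"
  by (metis rho_refl diff_add_cancel subspace_add subspace_diff subspace_scale)

text \<open>The map moving \<open>\<gamma>\<close> to \<open>\<rho> (refl \<beta>) \<gamma>\<close> unless the latter is negative matches the inversions of
  \<open>refl \<beta> \<otimes> w\<close> with the unpaired inversions of \<open>w\<close>. It respects every subspace containing \<open>\<beta>\<close>.\<close>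

lemma card_inversions_refl_mult:
  assumes w: "w \<in> carrier W" and \<beta>: "\<beta> \<in> inversions w" and P: "subspace P" "\<beta> \<in> P"
  shows "card (inversions w \<inter> P) =
    card (inversions (refl \<beta> \<otimes> w) \<inter> P) + card (paired_inversions w \<beta> \<inter> P)"
proof -
  let ?r = "\<rho> (refl \<beta>)"
  have pos: "\<beta> \<in> pos_roots" using \<beta> by (rule inversions_pos)
  then have root: "\<beta> \<in> roots" by simp
  define g where "g \<gamma> = (if ?r \<gamma> \<in> pos_roots then ?r \<gamma> else \<gamma>)" for \<gamma>
  have gP: "g \<gamma> \<in> P \<longleftrightarrow> \<gamma> \<in> P" for \<gamma>
    using subspace_refl[OF P(1) root P(2)] by (simp add: g_def)
  have gg: "g (g \<gamma>) = \<gamma>" if "\<gamma> \<in> pos_roots" for \<gamma>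
    using that root by (simp add: g_def)
  have neg: "- ?r \<gamma> \<in> pos_roots" if "\<gamma> \<in> pos_roots" "?r \<gamma> \<notin> pos_roots" for \<gamma>
    using that root not_pos_iff[of "?r \<gamma>"] by (simp add: root_rho)
  have to: "g \<gamma> \<in> inversions w - paired_inversions w \<beta>"
    if \<gamma>: "\<gamma> \<in> inversions (refl \<beta> \<otimes> w)" for \<gamma>
  proof -
    have \<gamma>': "\<gamma> \<in> pos_roots" "- \<rho> (inv w) (?r \<gamma>) \<in> pos_roots"
      using \<gamma> root w by (auto simp: inversions_refl_mult_iff)
    show ?thesis
    proof (cases "?r \<gamma> \<in> pos_roots")
      case True
      then have "?r \<gamma> \<in> inversions w" using \<gamma>' w by (simp add: inversions_iff)
      moreover have "?r \<gamma> \<notin> inversions (refl \<beta>)"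
        using \<gamma>' root pos_not_neg by (auto simp: inversions_refl_iff)
      ultimately show ?thesis using True by (auto simp: g_def paired_inversions_def)
    next
      case False
      have inv: "\<gamma> \<in> inversions (refl \<beta>)" using neg \<gamma>' False root by (simp add: inversions_refl_iff)
      have "- ?r \<gamma> \<notin> inversions w" using \<gamma>' w pos_not_neg by (auto simp: inversions_iff)
      then show ?thesis
        using inversion_partner[OF w \<beta>, of "- ?r \<gamma>"] refl_partner(1)[OF pos inv] root False
        by (auto simp: g_def paired_inversions_def)
    qed
  qed
  have unto: "g \<kappa> \<in> inversions (refl \<beta> \<otimes> w)"
    if \<kappa>: "\<kappa> \<in> inversions w" "\<kappa> \<notin> paired_inversions w \<beta>" for \<kappa>
  proof -
    have \<kappa>': "\<kappa> \<in> pos_roots" "- \<rho> (inv w) \<kappa> \<in> pos_roots"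
      using \<kappa> w by (auto simp: inversions_iff)
    show ?thesis
    proof (cases "?r \<kappa> \<in> pos_roots")
      case True
      then show ?thesis using \<kappa>' root w by (simp add: g_def inversions_refl_mult_iff)
    next
      case False
      have inv: "\<kappa> \<in> inversions (refl \<beta>)" using neg \<kappa>' False root by (simp add: inversions_refl_iff)
      then have "- ?r \<kappa> \<notin> inversions w" using \<kappa> by (simp add: paired_inversions_def)
      then have "\<rho> (inv w) (- ?r \<kappa>) \<in> pos_roots"
        using not_inversion[OF w] neg \<kappa>' False by blast
      then show ?thesis using \<kappa>' root w False by (simp add: g_def inversions_refl_mult_iff)
    qed
  qed
  have "bij_betw g (inversions (refl \<beta> \<otimes> w) \<inter> P) ((inversions w - paired_inversions w \<beta>) \<inter> P)"
  proof (rule bij_betw_byWitness[where f' = g])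
    show "\<forall>\<gamma>\<in>inversions (refl \<beta> \<otimes> w) \<inter> P. g (g \<gamma>) = \<gamma>"
      and "\<forall>\<kappa>\<in>(inversions w - paired_inversions w \<beta>) \<inter> P. g (g \<kappa>) = \<kappa>"
      using gg inversions_pos by blast+
  qed (use gP to unto in blast)+
  then have "card (inversions (refl \<beta> \<otimes> w) \<inter> P) =
      card ((inversions w - paired_inversions w \<beta>) \<inter> P)"
    by (rule bij_betw_same_card)
  also have "\<dots> + card (paired_inversions w \<beta> \<inter> P) = card (inversions w \<inter> P)"
    using paired_inversions_subset[of w \<beta>] inversions_finite_card(1)[OF w]
    by (subst card_Un_disjoint[symmetric]) (auto intro: finite_subset intro!: arg_cong[where f = card])
  finally show ?thesis by simp
qed

lemma card_inversions_refl_less: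
  assumes w: "w \<in> carrier W" and \<beta>: "\<beta> \<in> inversions w" and P: "subspace P" "\<beta> \<in> P"
  shows "card (inversions (refl \<beta> \<otimes> w) \<inter> P) < card (inversions w \<inter> P)"
proof -
  have "finite (paired_inversions w \<beta> \<inter> P)"
    using paired_inversions_subset inversions_finite_card(1)[OF w] finite_subset by blast
  then have "0 < card (paired_inversions w \<beta> \<inter> P)"
    using self_paired[OF \<beta>] P card_gt_0_iff by blast
  then show ?thesis using card_inversions_refl_mult[OF assms] by simp
qed

lemma refl_mult_inversion:
  assumes "w \<in> carrier W" "\<beta> \<in> pos_roots"
  shows "\<beta> \<in> inversions (refl \<beta> \<otimes> w) \<longleftrightarrow> \<beta> \<notin> inversions w"
  using assms not_inversion[OF assms] pos_not_neg
  by (auto simp: inversions_refl_mult_iff inversions_iff[OF assms(1)])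

lemma inversion_iff_card_less:
  assumes w: "w \<in> carrier W" and \<beta>: "\<beta> \<in> pos_roots" and P: "subspace P" "\<beta> \<in> P"
  shows "\<beta> \<in> inversions w \<longleftrightarrow> card (inversions (refl \<beta> \<otimes> w) \<inter> P) < card (inversions w \<inter> P)"
proof
  assume *: "card (inversions (refl \<beta> \<otimes> w) \<inter> P) < card (inversions w \<inter> P)"
  show "\<beta> \<in> inversions w"
  proof (rule ccontr)
    assume "\<beta> \<notin> inversions w"
    then have "\<beta> \<in> inversions (refl \<beta> \<otimes> w)" using refl_mult_inversion[OF w \<beta>] by simp
    from card_inversions_refl_less[OF _ this P] show False using * w \<beta> by simp
  qed
qed (rule card_inversions_refl_less[OF w _ P])

lemma inversion_iff_len_less:
  assumes "w \<in> carrier W" "\<beta> \<in> pos_roots"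
  shows "\<beta> \<in> inversions w \<longleftrightarrow> len (refl \<beta> \<otimes> w) < len w"
  using inversion_iff_card_less[OF assms, of UNIV] assms by (simp add: inversions_finite_card)

lemma len_refl_mult:
  assumes "w \<in> carrier W" "\<beta> \<in> inversions w"
  shows "len w = len (refl \<beta> \<otimes> w) + card (paired_inversions w \<beta>)"
  using card_inversions_refl_mult[OF assms, of UNIV] assms inversions_pos[of \<beta> w]
  by (simp add: inversions_finite_card)

lemma short_inversions_iff:
  assumes w: "w \<in> carrier W"
  shows "\<beta> \<in> short_inversions w \<longleftrightarrow> \<beta> \<in> inversions w \<and> paired_inversions w \<beta> = {\<beta>}"
proof (cases "\<beta> \<in> inversions w")
  case True
  have "card (paired_inversions w \<beta>) = 1 \<longleftrightarrow> paired_inversions w \<beta> = {\<beta>}"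
    using self_paired[OF True] by (auto simp: card_1_singleton_iff)
  moreover have "len (refl \<beta> \<otimes> w) + 1 = len w \<longleftrightarrow> card (paired_inversions w \<beta>) = 1"
    using len_refl_mult[OF w True] by linarith
  ultimately show ?thesis
    using True inversions_pos[OF True] by (simp add: short_inversions_def)
next
  case False
  then have "\<beta> \<notin> short_inversions w"
    using inversion_iff_len_less[OF w, of \<beta>] by (auto simp: short_inversions_def)
  then show ?thesis using False by blast
qed

lemma short_inversionD:
  assumes "w \<in> carrier W" "\<beta> \<in> short_inversions w"
  shows "\<beta> \<in> inversions w" "\<beta> \<in> pos_roots" "\<beta> \<in> roots" "len w = len (refl \<beta> \<otimes> w) + 1"
proof -
  show "\<beta> \<in> inversions w" using assms by (simp add: short_inversions_iff)
  then show "\<beta> \<in> pos_roots" by (rule inversions_pos)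
  then show "\<beta> \<in> roots" by simp
  show "len w = len (refl \<beta> \<otimes> w) + 1" using assms(2) by (simp add: short_inversions_def)
qed

lemma short_inversion_partner:
  assumes "w \<in> carrier W" "\<beta> \<in> short_inversions w"
    and "\<kappa> \<in> inversions (refl \<beta>)" "\<kappa> \<in> inversions w" "\<kappa> \<noteq> \<beta>"
  shows "- \<rho> (refl \<beta>) \<kappa> \<notin> inversions w"
  using assms by (auto simp: short_inversions_iff paired_inversions_def)

lemma short_inversion_card:
  assumes w: "w \<in> carrier W" and \<beta>: "\<beta> \<in> short_inversions w" and P: "subspace P" "\<beta> \<in> P"
  shows "card (inversions w \<inter> P) = card (inversions (refl \<beta> \<otimes> w) \<inter> P) + 1"
proof -
  have "\<beta> \<in> inversions w" "paired_inversions w \<beta> \<inter> P = {\<beta>}"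
    using \<beta> P by (auto simp: short_inversions_iff[OF w])
  then show ?thesis using card_inversions_refl_mult[OF w _ P] by simp
qed

end

subsection \<open>Generators of cones, planes and dihedral groups\<close>

lemma in_convex_cone_hull_insert:
  assumes "x \<in> convex_cone hull insert a Z"
  obtains c r where "0 \<le> c" "r \<in> convex_cone hull Z" "x = c *\<^sub>R a + r"
proof -
  have "convex_cone ((\<lambda>c. c *\<^sub>R a) ` {0..})"
    by (auto simp: convex_cone_iff simp flip: scaleR_add_left intro!: imageI)
  then have "convex_cone hull {a} \<subseteq> (\<lambda>c. c *\<^sub>R a) ` {0..}"
    by (intro hull_minimal) (auto intro: image_eqI[of _ _ 1])
  moreover obtain y r where "y \<in> convex_cone hull {a}" "r \<in> convex_cone hull Z" "x = y + r"
    using assms convex_cone_hull_Un[of "{a}" Z] by auto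
  ultimately show ?thesis using that by auto
qed

text \<open>A minimal generating subset of \<open>A\<close> cannot contain a vector that is decomposable in \<open>A\<close>,
  because the cone is pointed.\<close>

lemma indecomposables_generate:
  fixes A :: "'a::real_vector set"
  assumes A: "finite A" "A \<subseteq> K" and K: "convex_cone K" "\<And>x. x \<in> K \<Longrightarrow> - x \<in> K \<Longrightarrow> x = 0"
    and decomp: "\<And>x. x \<in> A - G \<Longrightarrow> \<exists>y\<in>A. \<exists>z\<in>A. \<exists>a b. 0 < a \<and> 0 < b \<and> x = a *\<^sub>R y + b *\<^sub>R z \<and>
      (\<forall>k. y \<noteq> k *\<^sub>R x)"
  shows "A \<subseteq> convex_cone hull G"
proof -
  define Gen where "Gen Y \<longleftrightarrow> Y \<subseteq> A \<and> A \<subseteq> convex_cone hull Y" for Y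
  have "Gen A" by (simp add: Gen_def hull_subset)
  then obtain Y where Y: "Gen Y" and min: "\<And>Z. Gen Z \<Longrightarrow> card Y \<le> card Z"
    using ex_has_least_nat[of Gen A card] by blast
  have "Y \<subseteq> G"
  proof (rule ccontr)
    assume "\<not> Y \<subseteq> G"
    then obtain x where x: "x \<in> Y" "x \<notin> G" by blast
    have xA: "x \<in> A" using x Y by (auto simp: Gen_def)
    then obtain y z a b where yz: "y \<in> A" "z \<in> A" "0 < a" "0 < b" "x = a *\<^sub>R y + b *\<^sub>R z"
      "\<forall>k. y \<noteq> k *\<^sub>R x"
      using decomp[of x] x by blast
    define Z where "Z = Y - {x}"
    have insert: "insert x Z = Y" using x by (auto simp: Z_def)
    have ZK: "convex_cone hull Z \<subseteq> K"
      using Y A K by (intro hull_minimal) (auto simp: Z_def Gen_def)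
    have "finite Y" using Y A finite_subset by (auto simp: Gen_def)
    then have "\<not> Gen Z" using min[of Z] x card_Diff1_less[of Y x] by (auto simp: Z_def)
    then have no: "x \<notin> convex_cone hull Z"
    proof (rule contrapos_nn)
      assume "x \<in> convex_cone hull Z"
      then have "convex_cone hull Y \<subseteq> convex_cone hull Z"
        using insert hull_subset[of Z convex_cone]
        by (intro hull_minimal) (auto simp: convex_cone_convex_cone_hull)
      then show "Gen Z" using Y by (auto simp: Gen_def Z_def)
    qed
    have "y \<in> convex_cone hull insert x Z" "z \<in> convex_cone hull insert x Z"
      unfolding insert using yz(1,2) Y by (auto simp: Gen_def)
    note in_Y = this
    obtain c r where cr: "0 \<le> c" "r \<in> convex_cone hull Z" "y = c *\<^sub>R x + r"
      by (rule in_convex_cone_hull_insert[OF in_Y(1)])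
    obtain d t where dt: "0 \<le> d" "t \<in> convex_cone hull Z" "z = d *\<^sub>R x + t"
      by (rule in_convex_cone_hull_insert[OF in_Y(2)])
    note cd = cr dt
    define e where "e = 1 - a * c - b * d"
    have "a *\<^sub>R r + b *\<^sub>R t = a *\<^sub>R y + b *\<^sub>R z - (a * c + b * d) *\<^sub>R x"
      unfolding cd(3,6) by (simp add: algebra_simps)
    also have "\<dots> = e *\<^sub>R x"
      unfolding yz(5)[symmetric] e_def by (simp add: algebra_simps)
    finally have e: "e *\<^sub>R x = a *\<^sub>R r + b *\<^sub>R t" by simp
    have rt: "a *\<^sub>R r \<in> convex_cone hull Z" "b *\<^sub>R t \<in> convex_cone hull Z"
      using convex_cone_hull_mul[OF cd(2)] convex_cone_hull_mul[OF cd(5)] yz(3,4) by simp_all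
    show False
    proof (cases "0 < e")
      case True
      have "(1 / e) *\<^sub>R (e *\<^sub>R x) \<in> convex_cone hull Z"
        unfolding e by (rule convex_cone_hull_mul[OF convex_cone_hull_add[OF rt]]) (use True in simp)
      then show False using no True by simp
    next
      case False
      have "(- e) *\<^sub>R x \<in> K" using convex_cone_scaleR[OF K(1), of "- e" x] False xA A(2) by auto
      then have "b *\<^sub>R t + (- e) *\<^sub>R x \<in> K" using rt ZK K(1) convex_cone_add by blast
      moreover have "b *\<^sub>R t + (- e) *\<^sub>R x = - (a *\<^sub>R r)" unfolding scaleR_minus_left e by simp
      moreover have "a *\<^sub>R r \<in> K" using rt ZK by blast
      ultimately have "a *\<^sub>R r = 0" by (intro K(2)) simp_all
      then have "y = c *\<^sub>R x" using yz(3) cd(3) by simp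
      then show False using yz(6) by blast
    qed
  qed
  then have "convex_cone hull Y \<subseteq> convex_cone hull G" by (rule hull_mono)
  then show ?thesis using Y by (auto simp: Gen_def)
qed

lemma span_pairE:
  assumes "x \<in> span {c, d}"
  obtains p q where "x = p *\<^sub>R c + q *\<^sub>R d"
proof -
  obtain p where "x - p *\<^sub>R c \<in> span {d}" using span_breakdown[of c "{c, d}" x] assms
    by (metis span_breakdown_eq)
  then obtain q where "x - p *\<^sub>R c = q *\<^sub>R d" by (auto simp: span_singleton)
  then show ?thesis using that[of p q] by (simp add: algebra_simps)
qed

lemma independent_pairI:
  fixes a b :: "'a::real_vector"
  assumes "a \<noteq> 0" "b \<noteq> 0" "\<And>k. b \<noteq> k *\<^sub>R a"
  shows "independent {a, b}"
proof -
  have "b \<notin> span {a}" using assms(3) by (auto simp: span_singleton)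
  then have "independent (insert b {a})"
    using assms(1) by (intro independent_insertI) (auto simp: independent_empty)
  then show ?thesis by (simp add: insert_commute)
qed

lemma span_pair_eqI:
  fixes a b c d :: "'a::real_vector"
  assumes "a \<in> span {c, d}" "b \<in> span {c, d}" "independent {a, b}" "a \<noteq> b"
  shows "span {c, d} = span {a, b}"
proof
  have "x \<in> span {a, b}" if x: "x \<in> span {c, d}" for x
  proof (rule ccontr)
    assume no: "x \<notin> span {a, b}"
    then have "independent (insert x {a, b})" by (rule independent_insertI[OF _ assms(3)])
    moreover have "insert x {a, b} \<subseteq> span {c, d}" using x assms by auto
    ultimately have "card (insert x {a, b}) \<le> card {c, d}"
      using independent_span_bound[of "{c, d}" "insert x {a, b}"] by simp
    moreover have "x \<notin> {a, b}" using no span_base[of x "{a, b}"] by blast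
    ultimately show False using assms(4) by (auto simp: card_insert_if split: if_splits)
  qed
  then show "span {c, d} \<subseteq> span {a, b}" by blast
  show "span {a, b} \<subseteq> span {c, d}" using assms by (intro span_minimal) auto
qed

context group
begin

definition dihedral_reflections :: "'a \<Rightarrow> 'a \<Rightarrow> 'a set" where
  "dihedral_reflections a b = {(a \<otimes> b) [^] k \<otimes> a |k::int. True}"

context
  fixes a b
  assumes ab: "a \<in> carrier G" "b \<in> carrier G" "a \<otimes> a = \<one>" "b \<otimes> b = \<one>"
begin

lemma involution_int_pow: "a \<otimes> (a \<otimes> b) [^] k = (a \<otimes> b) [^] (- k) \<otimes> a" for k :: int
proof -
  define c where "c = a \<otimes> b"
  have c: "c \<in> carrier G" "inv c = b \<otimes> a"
    using ab by (simp_all add: c_def inv_mult_group inv_equality)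
  have nat: "a \<otimes> c [^] n = inv c [^] n \<otimes> a" for n :: nat
  proof (induction n)
    case (Suc n)
    have "a \<otimes> c [^] Suc n = (a \<otimes> c [^] n) \<otimes> c" using ab c by (simp add: m_assoc)
    also have "\<dots> = inv c [^] n \<otimes> (a \<otimes> c)" using ab c Suc by (simp add: m_assoc)
    also have "a \<otimes> c = inv c \<otimes> a" using ab c(2) by (simp add: c_def m_assoc[symmetric]) (simp add: m_assoc)
    also have "inv c [^] n \<otimes> (inv c \<otimes> a) = inv c [^] Suc n \<otimes> a" using ab c(1) by (simp add: m_assoc)
    finally show ?case .
  qed (use ab in simp)
  have nat': "a \<otimes> inv c [^] n = c [^] n \<otimes> a" for n :: nat
  proof -
    have "c [^] n = a \<otimes> (a \<otimes> c [^] n)" using ab c by (simp flip: m_assoc)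
    then have "c [^] n \<otimes> a = a \<otimes> (inv c [^] n \<otimes> a) \<otimes> a" unfolding nat by simp
    also have "\<dots> = a \<otimes> inv c [^] n \<otimes> (a \<otimes> a)" using ab(1) c(1) by (simp only: m_assoc m_closed nat_pow_closed inv_closed)
    also have "\<dots> = a \<otimes> inv c [^] n" using ab c(1) by simp
    finally show ?thesis by simp
  qed
  have neg: "c [^] (- int n) = inv c [^] n" for n
    using c(1) by (simp add: int_pow_neg int_pow_int nat_pow_inv)
  show ?thesis
    using nat nat' neg unfolding c_def[symmetric]
    by (cases k rule: int_cases2) (simp_all add: int_pow_int)
qed

lemma dihedral_reflections_gens: "a \<in> dihedral_reflections a b" "b \<in> dihedral_reflections a b"
proof -
  have "a = (a \<otimes> b) [^] (0::int) \<otimes> a" using ab by simp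
  then show "a \<in> dihedral_reflections a b" unfolding dihedral_reflections_def by blast
  have "(a \<otimes> b) [^] (- 1 :: int) = b \<otimes> a"
    using ab by (simp add: int_pow_neg inv_mult_group inv_equality)
  then have "b = (a \<otimes> b) [^] (- 1 :: int) \<otimes> a" using ab by (simp add: m_assoc)
  then show "b \<in> dihedral_reflections a b" unfolding dihedral_reflections_def by blast
qed

lemma dihedral_reflections_triple:
  assumes "x \<in> dihedral_reflections a b" "y \<in> dihedral_reflections a b" "z \<in> dihedral_reflections a b"
  shows "x \<otimes> y \<otimes> z \<in> dihedral_reflections a b"
proof -
  define c where "c = a \<otimes> b"
  have c: "c \<in> carrier G" using ab by (simp add: c_def)
  obtain i j k :: int where ijk: "x = c [^] i \<otimes> a" "y = c [^] j \<otimes> a" "z = c [^] k \<otimes> a"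
    using assms by (auto simp: dihedral_reflections_def c_def)
  have "x \<otimes> y \<otimes> z = c [^] i \<otimes> (a \<otimes> c [^] j) \<otimes> (a \<otimes> c [^] k) \<otimes> a"
    using ab(1) c by (simp add: ijk m_assoc)
  also have "\<dots> = c [^] i \<otimes> (c [^] (- j) \<otimes> a) \<otimes> (a \<otimes> c [^] k) \<otimes> a"
    using involution_int_pow[of j] by (simp add: c_def)
  also have "\<dots> = c [^] i \<otimes> c [^] (- j) \<otimes> ((a \<otimes> a) \<otimes> c [^] k) \<otimes> a"
    using ab(1) c by (simp only: m_assoc m_closed int_pow_closed)
  also have "\<dots> = c [^] (i + - j + k) \<otimes> a"
    using ab(1,3) c by (simp only: l_one int_pow_closed int_pow_mult)
  finally show ?thesis unfolding dihedral_reflections_def c_def by blast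
qed

lemma dihedral_reflections_conjugate:
  assumes "x \<in> dihedral_reflections a b"
  obtains m where "m \<in> generate G {a, b}" "x = m \<otimes> a \<otimes> inv m \<or> x = m \<otimes> b \<otimes> inv m"
proof -
  define c where "c = a \<otimes> b"
  have c: "c \<in> carrier G" using ab by (simp add: c_def)
  have sub: "subgroup (generate G {a, b}) G" using ab by (intro generate_is_subgroup) auto
  have a_in: "a \<in> generate G {a, b}" and "b \<in> generate G {a, b}" by (auto intro: generate.incl)
  then have "c \<in> generate G {a, b}" using sub by (simp add: c_def subgroup.m_closed)
  then have c_in: "c [^] j \<in> generate G {a, b}" for j :: int
    using sub by (rule subgroup_int_pow_closed[rotated])
  obtain k :: int where k: "x = c [^] k \<otimes> a" using assms by (auto simp: dihedral_reflections_def c_def)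
  define j where "j = k div 2"
  have shift: "a \<otimes> inv (c [^] j) = c [^] j \<otimes> a"
    using involution_int_pow[of "- j"] c by (simp add: int_pow_neg flip: c_def)
  show ?thesis
  proof (cases "even k")
    case True
    have "c [^] j \<otimes> a \<otimes> inv (c [^] j) = c [^] j \<otimes> (c [^] j \<otimes> a)"
      using shift ab(1) c by (simp add: m_assoc)
    also have "\<dots> = c [^] (j + j) \<otimes> a" using ab(1) c by (simp only: int_pow_mult m_assoc int_pow_closed)
    also have "j + j = k" using True by (simp add: j_def)
    finally show ?thesis using that[OF c_in] k by metis
  next
    case False
    let ?m = "c [^] j \<otimes> a"
    have "?m \<otimes> b \<otimes> inv ?m = c [^] j \<otimes> c \<otimes> (a \<otimes> inv (c [^] j))"
      using ab c by (simp add: inv_mult_group inv_equality[of a a] m_assoc c_def)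
    also have "\<dots> = c [^] j \<otimes> c [^] (1::int) \<otimes> c [^] j \<otimes> a"
      using ab(1) c by (simp add: shift m_assoc)
    also have "\<dots> = c [^] (j + 1 + j) \<otimes> a"
      using c by (simp only: int_pow_mult)
    also have "j + 1 + j = k" using False by (simp add: j_def)
    finally have "x = ?m \<otimes> b \<otimes> inv ?m" using k by simp
    moreover have "?m \<in> generate G {a, b}" using c_in a_in sub by (simp add: subgroup.m_closed)
    ultimately show ?thesis using that by blast
  qed
qed

lemma dihedral_reflections_subset: "dihedral_reflections a b \<subseteq> generate G {a, b}"
proof
  fix x assume "x \<in> dihedral_reflections a b"
  then obtain m where m: "m \<in> generate G {a, b}" "x = m \<otimes> a \<otimes> inv m \<or> x = m \<otimes> b \<otimes> inv m"
    by (rule dihedral_reflections_conjugate)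
  have sub: "subgroup (generate G {a, b}) G" using ab by (intro generate_is_subgroup) auto
  have "a \<in> generate G {a, b}" "b \<in> generate G {a, b}" by (auto intro: generate.incl)
  then show "x \<in> generate G {a, b}"
    using m sub by (auto intro!: subgroup.m_closed subgroup.m_inv_closed)
qed

end

end

subsection \<open>Rank two root subsystems\<close>

context geometric_representation
begin

lemma inversions_in_short_cone:
  assumes x: "x \<in> carrier W"
  shows "inversions x \<subseteq> convex_cone hull short_inversions x"
proof (rule indecomposables_generate)
  show "finite (inversions x)" using x by (rule inversions_finite_card)
  show "inversions x \<subseteq> cone" using inversions_pos by (auto simp: pos_roots_iff)
  show "convex_cone cone" by (rule convex_cone_convex_cone_hull)
  show "v = 0" if "v \<in> cone" "- v \<in> cone" for v using that by (rule cone_pointed)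
next
  fix \<gamma> assume \<gamma>: "\<gamma> \<in> inversions x - short_inversions x"
  then have pos: "\<gamma> \<in> pos_roots" using inversions_pos by blast
  obtain \<kappa> where \<kappa>: "\<kappa> \<in> paired_inversions x \<gamma>" "\<kappa> \<noteq> \<gamma>"
    using \<gamma> self_paired[of \<gamma> x] by (auto simp: short_inversions_iff[OF x])
  let ?\<mu> = "- \<rho> (refl \<gamma>) \<kappa>"
  have in_inv: "\<kappa> \<in> inversions x" "?\<mu> \<in> inversions x" and refl: "\<kappa> \<in> inversions (refl \<gamma>)"
    using \<kappa> by (auto simp: paired_inversions_def)
  define c where "c = 2 * B \<kappa> \<gamma>"
  have c: "0 < c" "\<kappa> + ?\<mu> = c *\<^sub>R \<gamma>" using refl_partner[OF pos refl] by (auto simp: c_def)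
  have "(1 / c) *\<^sub>R \<kappa> + (1 / c) *\<^sub>R ?\<mu> = (1 / c) *\<^sub>R (\<kappa> + ?\<mu>)" by (simp only: scaleR_add_right)
  also have "\<dots> = \<gamma>" unfolding c(2) using c(1) by simp
  finally have "\<gamma> = (1 / c) *\<^sub>R \<kappa> + (1 / c) *\<^sub>R ?\<mu>" by simp
  moreover have "\<forall>k. \<kappa> \<noteq> k *\<^sub>R \<gamma>"
    using pos_roots_parallel[OF inversions_pos[OF in_inv(1)] pos] \<kappa>(2) by blast
  ultimately show "\<exists>y\<in>inversions x. \<exists>z\<in>inversions x. \<exists>a b. 0 < a \<and> 0 < b \<and>
      \<gamma> = a *\<^sub>R y + b *\<^sub>R z \<and> (\<forall>k. y \<noteq> k *\<^sub>R \<gamma>)"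
    using in_inv c(1) by (intro bexI[of _ \<kappa>] bexI[of _ ?\<mu>] exI[of _ "1 / c"]) auto
qed

text \<open>For a plane \<open>P\<close> spanned by roots these are the canonical simple roots of the maximal dihedral subgroup
  with root system \<open>roots \<inter> P\<close>.\<close>

definition plane_simple :: "'v set \<Rightarrow> 'v \<Rightarrow> bool" where
  "plane_simple P \<kappa> \<longleftrightarrow> \<kappa> \<in> pos_roots \<and> \<kappa> \<in> P \<and> inversions (refl \<kappa>) \<inter> P = {\<kappa>}"

lemma plane_simpleD: "plane_simple P \<kappa> \<Longrightarrow> \<kappa> \<in> pos_roots" "plane_simple P \<kappa> \<Longrightarrow> \<kappa> \<in> P"
  by (auto simp: plane_simple_def)

lemma plane_simple_reflection:
  assumes "subspace P" "plane_simple P \<delta>" "\<kappa> \<in> pos_roots" "\<kappa> \<in> P" "\<kappa> \<noteq> \<delta>"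
  shows "\<rho> (refl \<delta>) \<kappa> \<in> pos_roots" "\<rho> (refl \<delta>) \<kappa> \<in> P"
proof -
  have \<delta>: "\<delta> \<in> roots" "\<delta> \<in> P" using assms by (auto simp: plane_simple_def)
  have "\<kappa> \<notin> inversions (refl \<delta>)" using assms by (auto simp: plane_simple_def)
  then show "\<rho> (refl \<delta>) \<kappa> \<in> pos_roots"
    using not_inversion[of "refl \<delta>" \<kappa>] \<delta> assms by simp
  show "\<rho> (refl \<delta>) \<kappa> \<in> P" using subspace_refl[OF assms(1) \<delta>] assms by simp
qed

lemma plane_simpleI:
  assumes "\<delta> \<in> pos_roots" "\<delta> \<in> P"
    and "\<And>\<kappa>. \<kappa> \<in> pos_roots \<Longrightarrow> \<kappa> \<in> P \<Longrightarrow> \<kappa> \<noteq> \<delta> \<Longrightarrow> \<rho> (refl \<delta>) \<kappa> \<in> pos_roots"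
  shows "plane_simple P \<delta>"
proof -
  have "\<kappa> = \<delta>" if "\<kappa> \<in> inversions (refl \<delta>)" "\<kappa> \<in> P" for \<kappa>
    using that assms pos_not_neg[of "\<rho> (refl \<delta>) \<kappa>"] by (auto simp: inversions_refl_iff)
  then show ?thesis using assms(1,2) self_inversion by (auto simp: plane_simple_def)
qed

lemma simple_plane_simple:
  assumes "s \<in> S" "\<alpha> s \<in> P"
  shows "plane_simple P (\<alpha> s)"
  using assms simple_reflection_pos simple_pos by (intro plane_simpleI) auto

lemma first_plane_root:
  assumes P: "subspace P" and v: "v \<in> carrier W" "s \<in> S"
    and \<delta>: "\<rho> v (\<alpha> s) \<in> pos_roots" "\<rho> v (\<alpha> s) \<in> P" and empty: "inversions v \<inter> P = {}"
  shows "plane_simple P (\<rho> v (\<alpha> s))"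
proof (rule plane_simpleI[OF \<delta>])
  let ?\<delta> = "\<rho> v (\<alpha> s)"
  fix \<kappa> assume \<kappa>: "\<kappa> \<in> pos_roots" "\<kappa> \<in> P" "\<kappa> \<noteq> ?\<delta>"
  have "\<rho> (inv v) \<kappa> \<in> pos_roots" using not_inversion[OF v(1) \<kappa>(1)] empty \<kappa> by blast
  moreover have "\<rho> (inv v) \<kappa> \<noteq> \<alpha> s" using \<kappa>(3) v rho_inv_right by metis
  ultimately have "\<rho> s (\<rho> (inv v) \<kappa>) \<in> pos_roots" by (rule simple_reflection_pos[OF v(2)])
  also have "\<rho> s (\<rho> (inv v) \<kappa>) = \<rho> (inv v) (\<rho> (refl ?\<delta>) \<kappa>)"
    using v by (simp add: refl_rho_simple rho_mult)
  finally have *: "\<rho> (inv v) (\<rho> (refl ?\<delta>) \<kappa>) \<in> pos_roots" .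
  show "\<rho> (refl ?\<delta>) \<kappa> \<in> pos_roots"
  proof (rule ccontr)
    assume "\<rho> (refl ?\<delta>) \<kappa> \<notin> pos_roots"
    then have neg: "- \<rho> (refl ?\<delta>) \<kappa> \<in> pos_roots"
      using not_pos_iff[of "\<rho> (refl ?\<delta>) \<kappa>"] \<kappa> \<delta> by (simp add: root_rho)
    have "- \<rho> (refl ?\<delta>) \<kappa> \<in> P"
      using subspace_refl[OF P _ \<delta>(2)] \<kappa> \<delta> P by (simp add: subspace_neg)
    then have "- \<rho> (refl ?\<delta>) \<kappa> \<notin> inversions v" using empty by blast
    moreover have "- \<rho> (refl ?\<delta>) \<kappa> \<in> inversions v"
      using neg * v by (simp add: inversions_iff)
    ultimately show False by blast
  qed
qed

lemma plane_simple_in_inversions: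
  assumes P: "subspace P" and w: "w \<in> carrier W" and ne: "inversions w \<inter> P \<noteq> {}"
  shows "\<exists>\<delta>\<in>inversions w. plane_simple P \<delta>"
proof -
  obtain g where g: "inversions w = g ` {..<len w}"
    "\<forall>i<len w. \<exists>v\<in>carrier W. \<exists>s\<in>S. g i = \<rho> v (\<alpha> s) \<and> g i \<in> pos_roots \<and>
      inversions v = g ` {..<i} \<and> g i \<notin> inversions v"
    using inversion_chain[OF w] by blast
  define i where "i = (LEAST i. i < len w \<and> g i \<in> P)"
  have "\<exists>i. i < len w \<and> g i \<in> P" using ne g(1) by auto
  then have i: "i < len w" "g i \<in> P" unfolding i_def by (metis (mono_tags, lifting) LeastI_ex)+
  have "g j \<notin> P" if "j < i" for j
    using not_less_Least[OF that[unfolded i_def]] that i(1) by auto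
  moreover obtain v s where "v \<in> carrier W" "s \<in> S" "g i = \<rho> v (\<alpha> s)" "g i \<in> pos_roots"
    "inversions v = g ` {..<i}" using g(2) i(1) by blast
  ultimately have "plane_simple P (g i)"
    using first_plane_root[OF P, of v s] i(2) by auto
  then show ?thesis using g(1) i(1) by blast
qed

lemma plane_reduction:
  assumes P: "subspace P" and \<kappa>: "\<kappa> \<in> pos_roots" "\<kappa> \<in> P" and not: "\<not> plane_simple P \<kappa>"
  obtains \<epsilon> where "plane_simple P \<epsilon>" "\<rho> (refl \<epsilon>) \<kappa> \<in> pos_roots" "\<rho> (refl \<epsilon>) \<kappa> \<in> P"
    "len (refl (\<rho> (refl \<epsilon>) \<kappa>)) < len (refl \<kappa>)"
proof -
  obtain \<epsilon> where \<epsilon>: "\<epsilon> \<in> inversions (refl \<kappa>)" "plane_simple P \<epsilon>"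
    using plane_simple_in_inversions[OF P, of "refl \<kappa>"] self_inversion[OF \<kappa>(1)] \<kappa> by auto
  have ne: "\<kappa> \<noteq> \<epsilon>" using \<epsilon> not by auto
  have roots: "\<kappa> \<in> roots" "\<epsilon> \<in> pos_roots" "\<epsilon> \<in> roots" "\<epsilon> \<in> P"
    using \<kappa> \<epsilon> by (auto simp: plane_simple_def)
  note \<kappa>' = plane_simple_reflection[OF P \<epsilon>(2) \<kappa> ne]
  let ?\<mu> = "- \<rho> (refl \<kappa>) \<epsilon>"
  have \<mu>: "?\<mu> \<in> pos_roots" using \<epsilon>(1) roots by (simp add: inversions_refl_iff)
  have "?\<mu> \<in> P" using subspace_refl[OF P roots(1) \<kappa>(2)] roots P by (simp add: subspace_neg)
  moreover have "?\<mu> \<noteq> \<epsilon>"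
  proof
    assume "?\<mu> = \<epsilon>"
    then have "2 *\<^sub>R \<epsilon> = (2 * B \<epsilon> \<kappa>) *\<^sub>R \<kappa>"
      using refl_partner(2)[OF \<kappa>(1) \<epsilon>(1)] by (simp add: scaleR_2)
    then have "2 *\<^sub>R \<epsilon> = 2 *\<^sub>R (B \<epsilon> \<kappa> *\<^sub>R \<kappa>)" by simp
    then have "\<epsilon> = B \<epsilon> \<kappa> *\<^sub>R \<kappa>" by (metis scaleR_cancel_left zero_neq_numeral)
    then show False using pos_roots_parallel[OF roots(2) \<kappa>(1)] ne by blast
  qed
  ultimately have "\<rho> (refl \<epsilon>) ?\<mu> \<in> pos_roots" using plane_simple_reflection[OF P \<epsilon>(2) \<mu>] by blast
  then have inv: "\<epsilon> \<in> inversions (refl \<kappa> \<otimes> refl \<epsilon>)"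
    using roots by (simp add: inversions_iff refl_mult_inv rho_mult)
  have "refl (\<rho> (refl \<epsilon>) \<kappa>) = refl \<epsilon> \<otimes> (refl \<kappa> \<otimes> refl \<epsilon>)"
    using roots by (simp add: refl_rho m_assoc)
  then have "len (refl (\<rho> (refl \<epsilon>) \<kappa>)) < len (refl \<kappa> \<otimes> refl \<epsilon>)"
    using inversion_iff_len_less[of "refl \<kappa> \<otimes> refl \<epsilon>" \<epsilon>] inv roots by simp
  also have "\<dots> = len (refl \<epsilon> \<otimes> refl \<kappa>)"
    using len_inv[of "refl \<epsilon> \<otimes> refl \<kappa>"] roots by (simp add: refl_mult_inv)
  also have "\<dots> < len (refl \<kappa>)"
    using inversion_iff_len_less[of "refl \<kappa>" \<epsilon>] \<epsilon>(1) roots by simp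
  finally show ?thesis using that \<epsilon>(2) \<kappa>' by blast
qed

lemma plane_simple_not_combination:
  assumes P: "subspace P" and simple: "plane_simple P \<epsilon>"
    and \<gamma>: "\<gamma> \<in> pos_roots" "\<gamma> \<in> P" "\<gamma> \<noteq> \<epsilon>" and \<delta>: "\<delta> \<in> pos_roots" "\<delta> \<in> P" "\<delta> \<noteq> \<epsilon>"
    and pq: "0 \<le> p" "0 \<le> q"
  shows "\<epsilon> \<noteq> p *\<^sub>R \<gamma> + q *\<^sub>R \<delta>"
proof
  assume eq: "\<epsilon> = p *\<^sub>R \<gamma> + q *\<^sub>R \<delta>"
  have \<epsilon>: "\<epsilon> \<in> pos_roots" using simple by (rule plane_simpleD)
  have "\<rho> (refl \<epsilon>) \<epsilon> = p *\<^sub>R \<rho> (refl \<epsilon>) \<gamma> + q *\<^sub>R \<rho> (refl \<epsilon>) \<delta>"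
    using \<epsilon> by (subst (2) eq) simp
  moreover have "\<rho> (refl \<epsilon>) \<epsilon> = - \<epsilon>" "- \<epsilon> \<in> roots" using \<epsilon> by (auto intro: root_minus)
  ultimately have "- \<epsilon> \<in> pos_roots"
    using plane_simple_reflection[OF P simple] \<gamma> \<delta> pq combination_pos by metis
  then show False using \<epsilon> pos_not_neg by blast
qed

lemma plane_combination:
  assumes "\<gamma> \<in> pos_roots" "\<delta> \<in> pos_roots" "\<gamma> \<noteq> \<delta>" "\<gamma> \<in> span {a, b}" "\<delta> \<in> span {a, b}"
    "x \<in> span {a, b}"
  obtains p q where "x = p *\<^sub>R \<gamma> + q *\<^sub>R \<delta>"
proof -
  have "independent {\<gamma>, \<delta>}"
    using assms pos_roots_parallel[OF assms(2,1)] root_nonzero by (intro independent_pairI) auto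
  then have "span {a, b} = span {\<gamma>, \<delta>}" using assms by (intro span_pair_eqI) auto
  then show ?thesis using span_pairE that assms(6) by metis
qed

lemma at_most_two_plane_simple:
  assumes P: "P = span {a, b}" and simple: "plane_simple P \<gamma>" "plane_simple P \<delta>" "plane_simple P \<epsilon>"
    and ne: "\<gamma> \<noteq> \<delta>"
  shows "\<epsilon> = \<gamma> \<or> \<epsilon> = \<delta>"
proof (rule ccontr)
  assume "\<not> ?thesis"
  then have ne': "\<gamma> \<noteq> \<epsilon>" "\<delta> \<noteq> \<epsilon>" "\<epsilon> \<noteq> \<gamma>" "\<epsilon> \<noteq> \<delta>" by auto
  have sub: "subspace P" by (simp add: P)
  note pos = simple[THEN plane_simpleD(1)] and inP = simple[THEN plane_simpleD(2)]
  obtain p q where pq: "\<epsilon> = p *\<^sub>R \<gamma> + q *\<^sub>R \<delta>"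
    using plane_combination[OF pos(1,2) ne] inP P by blast
  note no_comb = plane_simple_not_combination[OF sub]
  consider "0 \<le> p" "0 \<le> q" | "p \<le> 0" "q \<le> 0" | "p < 0" "0 < q" | "0 < p" "q < 0"
    by linarith
  then show False
  proof cases
    case 1
    then show ?thesis
      using no_comb[OF simple(3) pos(1) inP(1) ne'(1) pos(2) inP(2) ne'(2)] pq by blast
  next
    case 2
    have "- \<epsilon> = (- p) *\<^sub>R \<gamma> + (- q) *\<^sub>R \<delta>" using pq by simp
    then have "- \<epsilon> \<in> pos_roots"
      using combination_pos[OF root_minus[OF pos_root[OF pos(3)]] _ pos(1,2)] 2
      by (metis neg_0_le_iff_le)
    then show ?thesis using pos pos_not_neg by blast
  next
    case 3
    have "q *\<^sub>R \<delta> = \<epsilon> + (- p) *\<^sub>R \<gamma>" using pq by simp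
    then have "(1 / q) *\<^sub>R (q *\<^sub>R \<delta>) = (1 / q) *\<^sub>R \<epsilon> + (- p / q) *\<^sub>R \<gamma>"
      by (simp only: scaleR_add_right scaleR_scaleR) simp
    then have "\<delta> = (1 / q) *\<^sub>R \<epsilon> + (- p / q) *\<^sub>R \<gamma>" using 3 by simp
    moreover have "0 \<le> 1 / q" "0 \<le> - p / q" using 3 by (auto simp: divide_nonpos_pos)
    ultimately show ?thesis 
      using no_comb[OF simple(2) pos(3) inP(3) ne'(4) pos(1) inP(1) ne] by blast
  next
    case 4
    have "p *\<^sub>R \<gamma> = \<epsilon> + (- q) *\<^sub>R \<delta>" using pq by simp
    then have "(1 / p) *\<^sub>R (p *\<^sub>R \<gamma>) = (1 / p) *\<^sub>R \<epsilon> + (- q / p) *\<^sub>R \<delta>"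
      by (simp only: scaleR_add_right scaleR_scaleR) simp
    then have "\<gamma> = (1 / p) *\<^sub>R \<epsilon> + (- q / p) *\<^sub>R \<delta>" using 4 by simp
    moreover have "0 \<le> 1 / p" "0 \<le> - q / p" using 4 by (auto simp: divide_nonpos_pos)
    ultimately show ?thesis 
      using no_comb[OF simple(1) pos(3) inP(3) ne'(3) pos(2) inP(2) ne[symmetric]] by blast
  qed
qed


lemma two_plane_simple:
  assumes P: "subspace P" and ab: "a \<in> pos_roots" "b \<in> pos_roots" "a \<in> P" "b \<in> P" "a \<noteq> b"
  obtains \<gamma> \<delta> where "plane_simple P \<gamma>" "plane_simple P \<delta>" "\<gamma> \<noteq> \<delta>"
proof -
  obtain \<gamma> where \<gamma>: "plane_simple P \<gamma>"
    using plane_simple_in_inversions[OF P, of "refl a"] self_inversion[of a] ab by auto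
  define c where "c = (if a = \<gamma> then b else a)"
  have c: "c \<in> pos_roots" "c \<in> P" "c \<noteq> \<gamma>" using ab by (auto simp: c_def)
  have "\<exists>\<delta>. plane_simple P \<delta> \<and> \<delta> \<noteq> \<gamma>"
    using c
  proof (induction "len (refl c)" arbitrary: c rule: less_induct)
    case less
    show ?case
    proof (cases "plane_simple P c")
      case False
      then obtain \<epsilon> where \<epsilon>: "plane_simple P \<epsilon>" "\<rho> (refl \<epsilon>) c \<in> pos_roots" "\<rho> (refl \<epsilon>) c \<in> P"
        "len (refl (\<rho> (refl \<epsilon>) c)) < len (refl c)"
        using plane_reduction[OF P] less.prems by metis
      have "\<rho> (refl \<gamma>) c \<noteq> \<gamma>"
      proof
        assume "\<rho> (refl \<gamma>) c = \<gamma>"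
        then have "c = - \<gamma>" using plane_simpleD(1)[OF \<gamma>] by (metis pos_root rho_refl_refl rho_refl_self)
        then show False using less.prems plane_simpleD(1)[OF \<gamma>] pos_not_neg by blast
      qed
      then show ?thesis using less.hyps[OF \<epsilon>(4,2,3)] \<epsilon>(1) by metis
    qed (use less in blast)
  qed
  then show ?thesis using that \<gamma> by metis
qed

lemma plane_reflections:
  assumes P: "subspace P" and \<gamma>\<delta>: "plane_simple P \<gamma>" "plane_simple P \<delta>"
    and only: "\<And>\<epsilon>. plane_simple P \<epsilon> \<Longrightarrow> \<epsilon> = \<gamma> \<or> \<epsilon> = \<delta>"
    and \<kappa>: "\<kappa> \<in> roots" "\<kappa> \<in> P"
  shows "refl \<kappa> \<in> dihedral_reflections (refl \<gamma>) (refl \<delta>)"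
proof -
  let ?a = "refl \<gamma>" and ?b = "refl \<delta>"
  have roots: "\<gamma> \<in> roots" "\<delta> \<in> roots" using \<gamma>\<delta> by (auto dest: plane_simpleD)
  then have ab: "?a \<in> carrier W" "?b \<in> carrier W" "?a \<otimes> ?a = \<one>" "?b \<otimes> ?b = \<one>" by simp_all
  have pos: "refl \<kappa> \<in> dihedral_reflections ?a ?b" if "\<kappa> \<in> pos_roots" "\<kappa> \<in> P" for \<kappa>
    using that
  proof (induction "len (refl \<kappa>)" arbitrary: \<kappa> rule: less_induct)
    case less
    show ?case
    proof (cases "plane_simple P \<kappa>")
      case True
      then show ?thesis using only[OF True] dihedral_reflections_gens[OF ab] by auto
    next
      case False
      then obtain \<epsilon> where \<epsilon>: "plane_simple P \<epsilon>" "\<rho> (refl \<epsilon>) \<kappa> \<in> pos_roots" "\<rho> (refl \<epsilon>) \<kappa> \<in> P"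
        "len (refl (\<rho> (refl \<epsilon>) \<kappa>)) < len (refl \<kappa>)"
        using plane_reduction[OF P] less.prems by metis
      have \<epsilon>_root: "\<epsilon> \<in> roots" using \<epsilon>(1) by (auto dest: plane_simpleD)
      have "refl \<epsilon> \<in> dihedral_reflections ?a ?b"
        using only[OF \<epsilon>(1)] dihedral_reflections_gens[OF ab] by auto
      then have "refl \<epsilon> \<otimes> refl (\<rho> (refl \<epsilon>) \<kappa>) \<otimes> refl \<epsilon> \<in> dihedral_reflections ?a ?b"
        using less.hyps[OF \<epsilon>(4,2,3)] dihedral_reflections_triple[OF ab] by blast
      also have "refl \<epsilon> \<otimes> refl (\<rho> (refl \<epsilon>) \<kappa>) \<otimes> refl \<epsilon> = refl \<kappa>"
        using \<epsilon>_root less.prems by (simp add: refl_rho m_assoc)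
      finally show ?thesis .
    qed
  qed
  show ?thesis
  proof (cases "\<kappa> \<in> pos_roots")
    case False
    then have "- \<kappa> \<in> pos_roots" using \<kappa> not_pos_iff by blast
    then show ?thesis using pos[of "- \<kappa>"] \<kappa> P by (simp add: subspace_neg)
  qed (use pos \<kappa> in blast)
qed

lemma generate_refl_displacement:
  assumes roots: "\<gamma> \<in> roots" "\<delta> \<in> roots" and m: "m \<in> generate W {refl \<gamma>, refl \<delta>}"
  shows "\<rho> m v - v \<in> span {\<gamma>, \<delta>}"
proof -
  have gen: "\<rho> (refl \<beta>) v - v \<in> span {\<gamma>, \<delta>}" if "\<beta> \<in> {\<gamma>, \<delta>}" for v \<beta>
  proof -
    have "\<rho> (refl \<beta>) v - v = (- 2 * B v \<beta>) *\<^sub>R \<beta>" using that roots by (auto simp: rho_refl)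
    then show ?thesis using that by (simp only: span_scale span_base)
  qed
  have sub: "{refl \<gamma>, refl \<delta>} \<subseteq> carrier W" using roots by auto
  from m show ?thesis
  proof (induction arbitrary: v rule: generate.induct)
    case one
    then show ?case by (simp add: span_zero)
  next
    case (incl h)
    then show ?case using gen by blast
  next
    case (inv h)
    then show ?case using gen roots by auto
  next
    case (eng h1 h2)
    have "h1 \<in> carrier W" "h2 \<in> carrier W" using eng generate_incl[OF sub] by auto
    then have "\<rho> (h1 \<otimes> h2) v - v = (\<rho> h1 (\<rho> h2 v) - \<rho> h2 v) + (\<rho> h2 v - v)"
      by (simp add: rho_mult)
    then show ?case using eng.IH span_add by metis
  qed
qed

lemma generate_refl_root:
  assumes roots: "\<gamma> \<in> roots" "\<delta> \<in> roots" and \<beta>: "\<beta> \<in> roots"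
    and m: "refl \<beta> \<in> generate W {refl \<gamma>, refl \<delta>}"
  shows "\<beta> \<in> span {\<gamma>, \<delta>}"
proof -
  have "- \<beta> - \<beta> \<in> span {\<gamma>, \<delta>}"
    using generate_refl_displacement[OF roots m, of \<beta>] \<beta> by simp
  moreover have "- \<beta> - \<beta> = (- 2) *\<^sub>R \<beta>" by (simp add: scaleR_2)
  ultimately have "(- 1 / 2) *\<^sub>R ((- 2) *\<^sub>R \<beta>) \<in> span {\<gamma>, \<delta>}" by (metis span_scale)
  then show ?thesis by simp
qed

context
  fixes a b P
  assumes ab: "a \<in> pos_roots" "b \<in> pos_roots" "a \<noteq> b" and P_def: "P = span {a, b}"
begin

lemma plane_subspace: "subspace P" and plane_mem: "a \<in> P" "b \<in> P"
  by (simp_all add: P_def span_base)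

lemma plane_independent: "independent {a, b}"
  using ab pos_roots_parallel[OF ab(2,1)] root_nonzero by (intro independent_pairI) auto

lemma plane_basis:
  obtains \<gamma> \<delta> where "plane_simple P \<gamma>" "plane_simple P \<delta>" "\<gamma> \<noteq> \<delta>"
    "\<And>\<epsilon>. plane_simple P \<epsilon> \<Longrightarrow> \<epsilon> = \<gamma> \<or> \<epsilon> = \<delta>"
    "\<And>\<kappa>. \<kappa> \<in> roots \<Longrightarrow> \<kappa> \<in> P \<Longrightarrow> refl \<kappa> \<in> dihedral_reflections (refl \<gamma>) (refl \<delta>)"
proof -
  obtain \<gamma> \<delta> where \<gamma>\<delta>: "plane_simple P \<gamma>" "plane_simple P \<delta>" "\<gamma> \<noteq> \<delta>"
    using two_plane_simple[OF plane_subspace ab(1,2) plane_mem ab(3)] by blast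
  have only: "\<epsilon> = \<gamma> \<or> \<epsilon> = \<delta>" if "plane_simple P \<epsilon>" for \<epsilon>
    using at_most_two_plane_simple[OF P_def \<gamma>\<delta>(1,2) that \<gamma>\<delta>(3)] .
  show ?thesis
    using that[OF \<gamma>\<delta> only plane_reflections[OF plane_subspace \<gamma>\<delta>(1,2) only]] by blast
qed

lemma plane_triple_reflection:
  assumes "\<kappa>1 \<in> roots" "\<kappa>1 \<in> P" "\<kappa>2 \<in> roots" "\<kappa>2 \<in> P" "\<kappa>3 \<in> roots" "\<kappa>3 \<in> P"
  obtains \<rho>' where "\<rho>' \<in> pos_roots" "\<rho>' \<in> P" "refl \<kappa>1 \<otimes> refl \<kappa>2 \<otimes> refl \<kappa>3 = refl \<rho>'"
proof -
  obtain \<gamma> \<delta> where \<gamma>\<delta>: "plane_simple P \<gamma>" "plane_simple P \<delta>"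
    and refls: "\<And>\<kappa>. \<kappa> \<in> roots \<Longrightarrow> \<kappa> \<in> P \<Longrightarrow> refl \<kappa> \<in> dihedral_reflections (refl \<gamma>) (refl \<delta>)"
    using plane_basis by metis
  have roots: "\<gamma> \<in> roots" "\<delta> \<in> roots" "\<gamma> \<in> P" "\<delta> \<in> P" using \<gamma>\<delta> by (auto dest: plane_simpleD)
  then have inv: "refl \<gamma> \<in> carrier W" "refl \<delta> \<in> carrier W"
    "refl \<gamma> \<otimes> refl \<gamma> = \<one>" "refl \<delta> \<otimes> refl \<delta> = \<one>" by simp_all
  let ?x = "refl \<kappa>1 \<otimes> refl \<kappa>2 \<otimes> refl \<kappa>3"
  have "?x \<in> dihedral_reflections (refl \<gamma>) (refl \<delta>)"
    using dihedral_reflections_triple[OF inv] refls assms by blast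
  then obtain m where m: "m \<in> generate W {refl \<gamma>, refl \<delta>}"
    "?x = m \<otimes> refl \<gamma> \<otimes> inv m \<or> ?x = m \<otimes> refl \<delta> \<otimes> inv m"
    by (rule dihedral_reflections_conjugate[OF inv])
  have m_closed: "m \<in> carrier W" using m(1) generate_incl[of "{refl \<gamma>, refl \<delta>}"] inv by auto
  have span: "span {\<gamma>, \<delta>} \<subseteq> P" using roots plane_subspace by (intro span_minimal) auto
  have in_P: "\<rho> m v \<in> P" if "v \<in> P" for v
  proof -
    have "\<rho> m v - v \<in> P" using generate_refl_displacement[OF roots(1,2) m(1)] span by blast
    then show ?thesis using that plane_subspace subspace_add by fastforce
  qed
  obtain \<beta> where \<beta>: "\<beta> \<in> roots" "\<beta> \<in> P" "?x = refl \<beta>"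
    using m(2) refl_rho[OF m_closed] roots in_P root_rho[OF _ m_closed] by metis
  show ?thesis
  proof (cases "\<beta> \<in> pos_roots")
    case True
    then show ?thesis using that \<beta> by blast
  next
    case False
    then have "- \<beta> \<in> pos_roots" using \<beta> not_pos_iff by blast
    then show ?thesis using that[of "- \<beta>"] \<beta> plane_subspace by (simp add: subspace_neg)
  qed
qed

lemma max_dihedral_eq_generate:
  assumes \<gamma>\<delta>: "plane_simple P \<gamma>" "plane_simple P \<delta>" "\<gamma> \<noteq> \<delta>"
    and refls: "\<And>\<kappa>. \<kappa> \<in> roots \<Longrightarrow> \<kappa> \<in> P \<Longrightarrow> refl \<kappa> \<in> dihedral_reflections (refl \<gamma>) (refl \<delta>)"
  shows "max_dihedral a b = generate W {refl \<gamma>, refl \<delta>}"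
proof -
  let ?M = "generate W {refl \<gamma>, refl \<delta>}"
  have pos: "\<gamma> \<in> pos_roots" "\<delta> \<in> pos_roots" using \<gamma>\<delta> by (auto dest: plane_simpleD)
  then have inv: "refl \<gamma> \<in> carrier W" "refl \<delta> \<in> carrier W"
    "refl \<gamma> \<otimes> refl \<gamma> = \<one>" "refl \<delta> \<otimes> refl \<delta> = \<one>" by simp_all
  have "refl \<gamma> \<noteq> refl \<delta>"
    using refl_eq_imp[of \<gamma> \<delta>] pos \<gamma>\<delta>(3) pos_not_neg by auto
  then have dihedral: "dihedral_reflection_subgroup ?M"
    unfolding dihedral_reflection_subgroup_def
    using pos by (intro bexI[of _ \<gamma>] bexI[of _ \<delta>]) auto
  have refl_M: "refl \<kappa> \<in> ?M" if "\<kappa> \<in> roots" "\<kappa> \<in> P" for \<kappa>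
    using refls[OF that] dihedral_reflections_subset[OF inv] by blast
  have ab_M: "refl a \<in> ?M" "refl b \<in> ?M" using refl_M ab plane_mem by auto
  have below: "M' \<subseteq> ?M"
    if M': "dihedral_reflection_subgroup M'" "refl a \<in> M'" "refl b \<in> M'" for M'
  proof -
    obtain c d where cd: "c \<in> roots" "d \<in> roots" "M' = generate W {refl c, refl d}"
      using M'(1) by (auto simp: dihedral_reflection_subgroup_def)
    have "a \<in> span {c, d}" "b \<in> span {c, d}"
      using generate_refl_root[OF cd(1,2)] M'(2,3) cd(3) ab by auto
    then have "span {c, d} = P"
      unfolding P_def using plane_independent ab(3) by (rule span_pair_eqI)
    then have "c \<in> P" "d \<in> P" by (auto intro: span_base)
    then have "{refl c, refl d} \<subseteq> ?M" using refl_M cd by auto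
    moreover have "subgroup ?M W" using inv by (intro generate_is_subgroup) auto
    ultimately show ?thesis unfolding cd(3) by (rule generate_subgroup_incl)
  qed
  show ?thesis
    unfolding max_dihedral_def
  proof (rule the_equality)
    show "dihedral_reflection_subgroup ?M \<and> refl a \<in> ?M \<and> refl b \<in> ?M \<and>
      (\<forall>M'. dihedral_reflection_subgroup M' \<and> ?M \<subseteq> M' \<longrightarrow> M' = ?M)"
      using dihedral ab_M below by blast
  qed (use dihedral below in blast)
qed

lemma subgroup_roots_max_dihedral: "subgroup_roots (max_dihedral a b) = roots \<inter> P"
proof -
  obtain \<gamma> \<delta> where \<gamma>\<delta>: "plane_simple P \<gamma>" "plane_simple P \<delta>" "\<gamma> \<noteq> \<delta>"
    and refls: "\<And>\<kappa>. \<kappa> \<in> roots \<Longrightarrow> \<kappa> \<in> P \<Longrightarrow> refl \<kappa> \<in> dihedral_reflections (refl \<gamma>) (refl \<delta>)"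
    using plane_basis by metis
  have roots: "\<gamma> \<in> roots" "\<delta> \<in> roots" "\<gamma> \<in> P" "\<delta> \<in> P" using \<gamma>\<delta> by (auto dest: plane_simpleD)
  have span: "span {\<gamma>, \<delta>} \<subseteq> P" using roots plane_subspace by (intro span_minimal) auto
  have inv: "refl \<gamma> \<in> carrier W" "refl \<delta> \<in> carrier W"
    "refl \<gamma> \<otimes> refl \<gamma> = \<one>" "refl \<delta> \<otimes> refl \<delta> = \<one>" using roots by simp_all
  have "refl \<kappa> \<in> generate W {refl \<gamma>, refl \<delta>} \<longleftrightarrow> \<kappa> \<in> P" if "\<kappa> \<in> roots" for \<kappa>
    using generate_refl_root[OF roots(1,2) that] span refls[OF that]
      dihedral_reflections_subset[OF inv] by blast
  moreover have "max_dihedral a b = generate W {refl \<gamma>, refl \<delta>}"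
    by (rule max_dihedral_eq_generate[OF \<gamma>\<delta>]) (rule refls)
  ultimately show ?thesis unfolding subgroup_roots_def by auto
qed

lemma canonical_simple_iff: "\<kappa> \<in> canonical_simple_roots (max_dihedral a b) \<longleftrightarrow> plane_simple P \<kappa>"
proof -
  have "inversions x \<inter> (roots \<inter> P) = inversions x \<inter> P" for x
    using inversions_pos pos_root by blast
  then show ?thesis
    unfolding canonical_simple_roots_def subgroup_roots_max_dihedral plane_simple_def by auto
qed

end

lemma short_step_iff:
  assumes w: "w \<in> carrier W"
  shows "short_step w a b \<longleftrightarrow>
    a \<in> short_inversions w \<and> b \<in> short_inversions w \<and> a \<noteq> b \<and> \<not> plane_simple (span {a, b}) b"
proof -
  have "span {a} \<noteq> span {b}" if "a \<in> pos_roots" "b \<in> pos_roots" "a \<noteq> b"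
  proof
    assume "span {a} = span {b}"
    then have "a \<in> span {b}" using span_base[of a "{a}"] by simp
    then obtain k where "a = k *\<^sub>R b" by (auto simp: span_singleton)
    then show False using pos_roots_parallel that by blast
  qed
  then show ?thesis
    using canonical_simple_iff[of a b _ b] short_inversionD(2)[OF w] by (auto simp: short_step_def)
qed

end

subsection \<open>Steps between short inversions\<close>

context geometric_representation
begin

lemma refl_inverts_simple:
  assumes "\<beta> \<in> roots"
  obtains s where "s \<in> S" "\<alpha> s \<in> inversions (refl \<beta>)"
proof -
  have "refl \<beta> \<noteq> \<one>"
  proof
    assume "refl \<beta> = \<one>"
    then have "- \<beta> = \<beta>" using rho_refl_self[OF assms] by simp
    then show False using pos_not_neg[of \<beta>] root_pos_or_neg[OF assms] by auto
  qed
  then obtain s where s: "s \<in> S" "len (refl \<beta>) = len (refl \<beta> \<otimes> s) + 1"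
    using right_descent_exists assms refl_closed by metis
  then have "- \<rho> (refl \<beta>) (\<alpha> s) \<in> cone" "- \<rho> (refl \<beta>) (\<alpha> s) \<in> roots"
    using descent_negative[of "refl \<beta>" s] assms by (auto simp: root_minus root_rho simple_root)
  then show ?thesis
    using that s(1) assms simple_pos by (simp add: inversions_refl_iff pos_roots_iff)
qed

text \<open>If no short inversion of \<open>x = refl \<beta> \<otimes> w\<close> were reflected to a negative root by \<open>\<beta>\<close>, then
  no inversion of \<open>x\<close> would be, since short inversions generate the cone of all inversions.\<close>

lemma short_inversion_below:
  assumes w: "w \<in> carrier W" and \<beta>: "\<beta> \<in> short_inversions w" and not: "\<beta> \<notin> simple_roots"
  shows "\<exists>\<gamma>\<in>short_inversions (refl \<beta> \<otimes> w). \<gamma> \<in> inversions (refl \<beta>)"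
proof (rule ccontr)
  assume no: "\<not> ?thesis"
  let ?x = "refl \<beta> \<otimes> w" and ?r = "\<rho> (refl \<beta>)"
  note D = short_inversionD[OF w \<beta>]
  have x: "?x \<in> carrier W" using D w by simp
  obtain s where s: "s \<in> S" "\<alpha> s \<in> inversions (refl \<beta>)" using refl_inverts_simple[OF D(3)] .
  obtain \<kappa> where \<kappa>: "\<kappa> \<in> inversions (refl \<beta>)" "\<kappa> \<in> inversions w" "\<kappa> \<noteq> \<beta>"
  proof (cases "\<alpha> s \<in> inversions w")
    case True
    then show ?thesis using that[of "\<alpha> s"] s not by (auto simp: simple_roots_def)
  next
    case False
    have "- ?r (\<alpha> s) \<noteq> \<beta>"
    proof
      assume "- ?r (\<alpha> s) = \<beta>"
      then have "\<alpha> s = \<beta>" using rho_refl_refl[OF D(3), of "\<alpha> s"] D(3)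
        by (metis add.inverse_inverse rho_refl_self rho_minus refl_closed)
      then show False using s not by (auto simp: simple_roots_def)
    qed
    then show ?thesis
      using that[of "- ?r (\<alpha> s)"] inversion_partner[OF w D(1) s(2) False] refl_partner(1)[OF D(2) s(2)]
      by blast
  qed
  have "- ?r \<kappa> \<notin> inversions w" using short_inversion_partner[OF w \<beta> \<kappa>] .
  then have "\<rho> (inv w) (- ?r \<kappa>) \<in> pos_roots"
    using not_inversion[OF w] \<kappa>(1) D(3) by (simp add: inversions_refl_iff)
  then have "\<kappa> \<in> inversions ?x"
    using \<kappa>(2) w D(3) by (simp add: inversions_refl_mult_iff inversions_pos)
  then have "\<kappa> \<in> convex_cone hull short_inversions ?x" using inversions_in_short_cone[OF x] by blast
  moreover have "convex_cone hull short_inversions ?x \<subseteq> {v. ?r v \<in> cone}"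
  proof (rule hull_minimal)
    show "short_inversions ?x \<subseteq> {v. ?r v \<in> cone}"
    proof
      fix \<gamma> assume \<gamma>: "\<gamma> \<in> short_inversions ?x"
      then have "\<gamma> \<in> pos_roots" "\<gamma> \<notin> inversions (refl \<beta>)" using no short_inversionD[OF x] by auto
      then have "?r \<gamma> \<in> pos_roots" using not_inversion[of "refl \<beta>" \<gamma>] D(3) by simp
      then show "\<gamma> \<in> {v. ?r v \<in> cone}" by (simp add: pos_roots_iff)
    qed
    show "convex_cone {v. ?r v \<in> cone}"
      using D(3) cone_add cone_scale convex_cone_hull_contains_0
      by (auto simp: convex_cone_iff)
  qed
  ultimately have "?r \<kappa> \<in> cone" by blast
  moreover have "- ?r \<kappa> \<in> pos_roots" using \<kappa>(1) D(3) by (simp add: inversions_refl_iff)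
  ultimately show False using cone_pointed[of "?r \<kappa>"] root_nonzero[of "- ?r \<kappa>"]
    by (auto simp: pos_roots_iff)
qed

text \<open>The first root \<open>\<delta>\<close> of the plane along the reduced word lies below \<open>\<beta>\<close>. To see that it is short,
  compare \<open>u = refl \<delta> \<otimes> w\<close> with \<open>y = refl \<gamma> \<otimes> refl \<beta> \<otimes> w\<close>: they differ by a reflection in the plane, and
  counting inversions in the plane shows that \<open>y\<close> is shorter than \<open>u\<close>. As \<open>len y = len w - 2\<close>, this
  leaves \<open>len u = len w - 1\<close>.\<close>

lemma short_step_below:
  assumes w: "w \<in> carrier W" and g: "inversions w = g ` {..<len w}"
    "\<forall>i<len w. \<exists>v\<in>carrier W. \<exists>s\<in>S. g i = \<rho> v (\<alpha> s) \<and> g i \<in> pos_roots \<and>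
      inversions v = g ` {..<i} \<and> g i \<notin> inversions v"
    and i: "i < len w" "g i \<in> short_inversions w" "g i \<notin> simple_roots"
  shows "\<exists>j<i. short_step w (g j) (g i)"
proof -
  define \<beta> where "\<beta> = g i"
  have \<beta>: "\<beta> \<in> short_inversions w" using i by (simp add: \<beta>_def)
  note D = short_inversionD[OF w \<beta>]
  let ?x = "refl \<beta> \<otimes> w"
  have x: "?x \<in> carrier W" using D w by simp
  obtain \<gamma> where \<gamma>: "\<gamma> \<in> short_inversions ?x" "\<gamma> \<in> inversions (refl \<beta>)"
    using short_inversion_below[OF w \<beta>] i by (auto simp: \<beta>_def)
  note E = short_inversionD[OF x \<gamma>(1)]
  have ne: "\<beta> \<noteq> \<gamma>" using E(1) refl_mult_inversion[OF w D(2)] D(1) by auto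
  define P where "P = span {\<beta>, \<gamma>}"
  have P: "subspace P" "\<beta> \<in> P" "\<gamma> \<in> P" by (auto simp: P_def span_base)
  have not_simple: "\<not> plane_simple P \<beta>" using \<gamma>(2) P(3) ne by (auto simp: plane_simple_def)
  define j where "j = (LEAST j. g j \<in> P)"
  have j: "g j \<in> P" "j \<le> i"
    using LeastI[of "\<lambda>j. g j \<in> P" i] Least_le[of "\<lambda>j. g j \<in> P" i] P(2) by (simp_all add: j_def \<beta>_def)
  then have j_len: "j < len w" using i by simp
  have "g k \<notin> P" if "k < j" for k using not_less_Least that by (simp add: j_def)
  moreover obtain v s where "v \<in> carrier W" "s \<in> S" "g j = \<rho> v (\<alpha> s)" "g j \<in> pos_roots"
    "inversions v = g ` {..<j}" using g(2) j_len by blast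
  ultimately have simple: "plane_simple P (g j)" using first_plane_root[OF P(1), of v s] j(1) by auto
  define \<delta> where "\<delta> = g j"
  have \<delta>: "\<delta> \<in> inversions w" "\<delta> \<in> pos_roots" "\<delta> \<in> roots" "\<delta> \<in> P" "plane_simple P \<delta>"
    using simple g(1) j_len plane_simpleD[OF simple] by (auto simp: \<delta>_def)
  have \<delta>_ne: "\<delta> \<noteq> \<beta>" using not_simple \<delta>(5) by blast
  have "j \<noteq> i" using \<delta>_ne by (auto simp: \<delta>_def \<beta>_def)
  then have j_less: "j < i" using j(2) by simp
  have "independent {\<delta>, \<beta>}"
    using \<delta>_ne pos_roots_parallel[OF D(2) \<delta>(2)] D(3) \<delta>(3) root_nonzero
    by (intro independent_pairI) auto
  then have span_eq: "span {\<delta>, \<beta>} = P"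
    using span_pair_eqI[of \<delta> \<beta> \<gamma> \<beta>] \<delta>(4) P(2) \<delta>_ne by (simp add: P_def)
  let ?u = "refl \<delta> \<otimes> w" and ?y = "refl \<gamma> \<otimes> ?x"
  have u: "?u \<in> carrier W" using \<delta> w by simp
  obtain \<epsilon> where \<epsilon>: "\<epsilon> \<in> pos_roots" "\<epsilon> \<in> P" "refl \<gamma> \<otimes> refl \<beta> \<otimes> refl \<delta> = refl \<epsilon>"
    using plane_triple_reflection[OF D(2) E(2) ne P_def E(3) P(3) D(3) P(2) \<delta>(3,4)] .
  have "refl \<epsilon> \<otimes> ?u = ?y"
    unfolding \<epsilon>(3)[symmetric] using D(3) E(3) \<delta>(3) w by (simp add: m_assoc)
  moreover have "card (inversions ?y \<inter> P) < card (inversions ?u \<inter> P)"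
  proof -
    have "paired_inversions w \<delta> \<inter> P = {\<delta>}"
      using \<delta> self_paired[OF \<delta>(1)] by (auto simp: paired_inversions_def plane_simple_def)
    then have "card (inversions w \<inter> P) = card (inversions ?u \<inter> P) + 1"
      using card_inversions_refl_mult[OF w \<delta>(1) P(1) \<delta>(4)] by simp
    then show ?thesis
      using short_inversion_card[OF w \<beta> P(1,2)] short_inversion_card[OF x \<gamma>(1) P(1,3)] by linarith
  qed
  ultimately have "\<epsilon> \<in> inversions ?u" using inversion_iff_card_less[OF u \<epsilon>(1) P(1) \<epsilon>(2)] by simp
  then have "len ?y < len ?u"
    using inversion_iff_len_less[OF u \<epsilon>(1)] \<open>refl \<epsilon> \<otimes> ?u = ?y\<close> by simp
  moreover have "len ?u < len w" using inversion_iff_len_less[OF w \<delta>(2)] \<delta>(1) by simp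
  ultimately have "len ?u + 1 = len w" using D(4) E(4) by linarith
  then have "\<delta> \<in> short_inversions w" using \<delta>(2) by (simp add: short_inversions_def)
  then have "short_step w \<delta> \<beta>"
    using \<beta> \<delta>_ne not_simple span_eq by (simp add: short_step_iff[OF w])
  then show ?thesis using j_less by (auto simp: \<delta>_def \<beta>_def)
qed

lemma left_descent_roots_eq:
  assumes w: "w \<in> carrier W"
  shows "left_descent_roots w = short_inversions w \<inter> simple_roots"
proof -
  have "\<alpha> s \<in> short_inversions w" if s: "s \<in> S" "\<alpha> s \<in> inversions w" for s
  proof -
    have "inversions (refl (\<alpha> s)) = {\<alpha> s}"
      using simple_plane_simple[OF s(1), of UNIV] by (simp add: plane_simple_def)
    then show ?thesis
      using s(2) self_paired[OF s(2)] by (auto simp: short_inversions_iff[OF w] paired_inversions_def)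
  qed
  then show ?thesis
    using short_inversionD(1)[OF w] by (auto simp: left_descent_roots_def simple_roots_def)
qed

lemma exists_left_descent_below:
  assumes w: "w \<in> carrier W" and \<beta>: "\<beta> \<in> short_inversions w"
  shows "\<exists>a\<in>left_descent_roots w. (short_step w)\<^sup>*\<^sup>* a \<beta>"
proof -
  obtain g where g: "inversions w = g ` {..<len w}"
    "\<forall>i<len w. \<exists>v\<in>carrier W. \<exists>s\<in>S. g i = \<rho> v (\<alpha> s) \<and> g i \<in> pos_roots \<and>
      inversions v = g ` {..<i} \<and> g i \<notin> inversions v"
    using inversion_chain[OF w] by blast
  have "\<exists>a\<in>left_descent_roots w. (short_step w)\<^sup>*\<^sup>* a (g i)"
    if "i < len w" "g i \<in> short_inversions w" for i
    using that
  proof (induction i rule: less_induct)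
    case (less i)
    show ?case
    proof (cases "g i \<in> simple_roots")
      case True
      then show ?thesis using less.prems left_descent_roots_eq[OF w] by blast
    next
      case False
      then obtain j where j: "j < i" "short_step w (g j) (g i)"
        using short_step_below[OF w g less.prems] by blast
      then have "g j \<in> short_inversions w" by (simp add: short_step_def)
      then obtain a where "a \<in> left_descent_roots w" "(short_step w)\<^sup>*\<^sup>* a (g j)"
        using less.IH[OF j(1)] j(1) less.prems by auto
      then show ?thesis using j(2) by (meson rtranclp.rtrancl_into_rtrancl)
    qed
  qed
  moreover obtain i where "i < len w" "\<beta> = g i"
    using short_inversionD(1)[OF w \<beta>] g(1) by auto
  ultimately show ?thesis using \<beta> by blast
qed

text \<open>Passing from \<open>w\<close> to \<open>inv w\<close> via \<open>\<beta> \<mapsto> - \<rho> (inv w) \<beta>\<close> reverses the steps.\<close>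

lemma short_inversion_inv:
  assumes w: "w \<in> carrier W" and \<beta>: "\<beta> \<in> short_inversions w"
  shows "- \<rho> (inv w) \<beta> \<in> short_inversions (inv w)"
proof -
  note D = short_inversionD[OF w \<beta>]
  have "- \<rho> (inv w) \<beta> \<in> pos_roots" using D(1) w by (simp add: inversions_iff)
  moreover have "refl (- \<rho> (inv w) \<beta>) \<otimes> inv w = inv (refl \<beta> \<otimes> w)"
    using w D(3) root_rho by (simp add: refl_rho m_assoc refl_mult_inv)
  ultimately show ?thesis
    using D(4) w D(3) by (simp add: short_inversions_def len_inv)
qed

lemma positive_sum_multiple:
  assumes "x \<in> pos_roots" "y \<in> cone" "b \<in> cone" "x + y = k *\<^sub>R b"
  shows "0 < k"
proof (rule ccontr)
  assume "\<not> 0 < k"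
  then have "y + (- k) *\<^sub>R b \<in> cone" using assms by (intro cone_add cone_scale) auto
  moreover have "- x = y + (- k) *\<^sub>R b" using assms(4) by (simp add: algebra_simps)
  ultimately show False
    using cone_pointed[of x] assms(1) root_nonzero[of x] by (simp add: pos_roots_iff)
qed

lemma nonsimple_reversed:
  assumes w: "w \<in> carrier W" and a: "a \<in> short_inversions w" and b: "b \<in> short_inversions w"
    and ne: "a \<noteq> b" and not: "\<not> plane_simple (span {a, b}) b"
  shows "\<not> plane_simple (span {- \<rho> (inv w) b, - \<rho> (inv w) a}) (- \<rho> (inv w) a)"
proof
  define P where "P = span {a, b}"
  let ?f = "\<lambda>v. \<rho> (inv w) (\<rho> (refl a) v)"
  let ?Q = "span {- \<rho> (inv w) b, - \<rho> (inv w) a}"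
  assume simple: "plane_simple ?Q (- \<rho> (inv w) a)"
  note A = short_inversionD[OF w a] and D = short_inversionD[OF w b]
  have P: "subspace P" "a \<in> P" "b \<in> P" by (auto simp: P_def span_base)
  have Q: "\<rho> (inv w) v \<in> ?Q" if v: "v \<in> P" for v
  proof -
    obtain p q where "v = p *\<^sub>R a + q *\<^sub>R b" using v[unfolded P_def] by (rule span_pairE)
    then have "\<rho> (inv w) v = (- p) *\<^sub>R (- \<rho> (inv w) a) + (- q) *\<^sub>R (- \<rho> (inv w) b)" using w by simp
    then show ?thesis by (simp only: span_add span_scale span_base insertI1 insertI2)
  qed
  have f: "\<rho> (refl (- \<rho> (inv w) a)) (\<rho> (inv w) v) = ?f v" for v
    using w A(3) root_rho by (simp add: refl_rho rho_mult)
  have f_neg: "- ?f v \<in> pos_roots" if "v \<in> inversions w" "v \<in> P" "v \<noteq> a" for v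
  proof -
    have "- \<rho> (inv w) v \<in> pos_roots" "- \<rho> (inv w) v \<in> ?Q" "- \<rho> (inv w) v \<noteq> - \<rho> (inv w) a"
      using that w Q by (auto simp: inversions_iff span_neg rho_eq_iff)
    from plane_simple_reflection(1)[OF subspace_span simple this] show ?thesis
      using f[of "- v"] w A(3) by simp
  qed
  have f_pos: "?f v \<in> pos_roots" if "v \<in> pos_roots" "v \<notin> inversions w" "v \<in> P" for v
  proof -
    have "\<rho> (inv w) v \<in> pos_roots" using not_inversion[OF w] that by blast
    moreover have "\<rho> (inv w) v \<noteq> - \<rho> (inv w) a"
      using rho_eq_iff[of "inv w" v "- a"] w that A(2) pos_not_neg by auto
    ultimately show ?thesis
      using plane_simple_reflection(1)[OF subspace_span simple] Q[OF that(3)] f by metis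
  qed
  have f_a: "?f a \<in> pos_roots" using A(1,3) w by (simp add: inversions_iff)
  obtain \<delta>0 where \<delta>0: "\<delta>0 \<in> inversions (refl b)" "\<delta>0 \<in> P" "\<delta>0 \<noteq> b"
    using not D(2) P(3) self_inversion[OF D(2)] unfolding plane_simple_def P_def by blast
  have partner_P: "- \<rho> (refl b) v \<in> P" if "v \<in> P" for v
    using subspace_refl[OF P(1) D(3) P(3)] that P(1) by (simp add: subspace_neg)
  obtain \<delta> where \<delta>: "\<delta> \<in> inversions (refl b)" "\<delta> \<in> P" "\<delta> \<noteq> b" "\<delta> \<in> inversions w"
  proof (cases "\<delta>0 \<in> inversions w")
    case True
    then show ?thesis using that \<delta>0 by blast
  next
    case False
    have "- \<rho> (refl b) \<delta>0 \<noteq> b"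
      using \<delta>0(3) D(3) by (metis add.inverse_inverse rho_refl_refl rho_refl_self rho_minus refl_closed)
    then show ?thesis
      using that[of "- \<rho> (refl b) \<delta>0"] inversion_partner[OF w D(1) \<delta>0(1) False]
        refl_partner(1)[OF D(2) \<delta>0(1)] partner_P[OF \<delta>0(2)] by blast
  qed
  define \<delta>' where "\<delta>' = - \<rho> (refl b) \<delta>"
  define c where "c = 2 * B \<delta> b"
  have \<delta>': "\<delta>' \<in> pos_roots" "\<delta>' \<notin> inversions w" "\<delta>' \<in> P"
    using refl_partner(1)[OF D(2) \<delta>(1)] inversions_pos short_inversion_partner[OF w b \<delta>(1,4,3)]
      partner_P[OF \<delta>(2)] by (auto simp: \<delta>'_def)
  have c: "0 < c" "\<delta> + \<delta>' = c *\<^sub>R b"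
    using refl_partner(2,3)[OF D(2) \<delta>(1)] by (auto simp: c_def \<delta>'_def)
  have \<delta>_pos: "\<delta> \<in> pos_roots" using \<delta>(4) by (rule inversions_pos)
  have f_b: "- ?f b \<in> pos_roots" using f_neg[OF D(1) P(3)] ne by blast
  have f_\<delta>': "?f \<delta>' \<in> pos_roots" using f_pos[OF \<delta>'] .
  have f_sum: "?f \<delta> + ?f \<delta>' = c *\<^sub>R ?f b"
  proof -
    have "?f (\<delta> + \<delta>') = ?f (c *\<^sub>R b)" by (simp only: c)
    then show ?thesis using w A(3) by simp
  qed
  have f_b_root: "?f b \<in> roots" using w A(3) D(3) by (intro root_rho) auto
  have f_b_not: False if "c' *\<^sub>R ?f b \<in> cone" "0 < c'" for c'
    using pos_of_positive_multiple[OF f_b_root that] f_b pos_not_neg by blast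
  have "\<delta> \<noteq> a"
  proof
    assume "\<delta> = a"
    then have "c *\<^sub>R ?f b \<in> cone" using f_sum f_a f_\<delta>' cone_add by (metis pos_roots_iff)
    then show False using f_b_not c(1) by blast
  qed
  then have f_\<delta>: "- ?f \<delta> \<in> pos_roots" using f_neg \<delta> by blast
  obtain p q where pq: "a = p *\<^sub>R b + q *\<^sub>R \<delta>"
    using plane_combination[OF D(2) \<delta>_pos, of a b a] \<delta>(2,3) P(2,3) unfolding P_def by blast
  consider "0 \<le> p" "0 \<le> q" | "p \<le> 0" "q \<le> 0" | "p < 0" "0 < q" | "0 < p" "q < 0" by linarith
  then show False
  proof cases
    case 1
    have "?f a = ?f (p *\<^sub>R b + q *\<^sub>R \<delta>)" by (simp only: pq[symmetric])
    then have "- ?f a = p *\<^sub>R (- ?f b) + q *\<^sub>R (- ?f \<delta>)" using w A(3) by simp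
    moreover have "- ?f a \<in> roots" using f_a by (intro root_minus) simp
    ultimately have "- ?f a \<in> pos_roots" using combination_pos f_b f_\<delta> 1 by blast
    then show False using f_a pos_not_neg by blast
  next
    case 2
    have "- a = (- p) *\<^sub>R b + (- q) *\<^sub>R \<delta>" by (subst pq) simp
    then have "- a \<in> pos_roots"
      using combination_pos[OF root_minus[OF A(3)] _ D(2) \<delta>_pos] 2 by (metis neg_0_le_iff_le)
    then show False using A(2) pos_not_neg by blast
  next
    case 3
    define k where "k = q * c + p"
    have "a + q *\<^sub>R \<delta>' = p *\<^sub>R b + q *\<^sub>R (\<delta> + \<delta>')" by (subst pq) (simp add: algebra_simps)
    also have "\<dots> = k *\<^sub>R b" unfolding c(2) k_def by (simp add: algebra_simps)
    finally have eq: "a + q *\<^sub>R \<delta>' = k *\<^sub>R b" .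
    have "q *\<^sub>R \<delta>' \<in> cone" "b \<in> cone" using 3 \<delta>'(1) D(2) by (auto simp: pos_roots_iff cone_scale)
    then have k: "0 < k" using positive_sum_multiple[OF A(2) _ _ eq] by blast
    have "?f (a + q *\<^sub>R \<delta>') = ?f (k *\<^sub>R b)" by (simp only: eq)
    then have "k *\<^sub>R ?f b = ?f a + q *\<^sub>R ?f \<delta>'" using w A(3) by simp
    moreover have "?f a + q *\<^sub>R ?f \<delta>' \<in> cone"
      using f_a f_\<delta>' 3 by (intro cone_add cone_scale) (simp_all only: pos_roots_iff less_imp_le)
    ultimately show False using f_b_not k by metis
  next
    case 4
    define t where "t = p + q * c"
    have \<delta>_eq: "\<delta> = c *\<^sub>R b - \<delta>'" using c(2) by (simp add: algebra_simps)
    have eq: "a = t *\<^sub>R b + (- q) *\<^sub>R \<delta>'" by (subst pq, subst \<delta>_eq) (simp add: t_def algebra_simps)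
    show False
    proof (cases "0 < t")
      case True
      have "\<rho> (refl b) (t *\<^sub>R b + (- q) *\<^sub>R \<delta>') = (- t) *\<^sub>R b + q *\<^sub>R \<delta>"
        using D(3) by (simp add: \<delta>'_def)
      then have r: "- \<rho> (refl b) a = t *\<^sub>R b + (- q) *\<^sub>R \<delta>" using eq by simp
      have root: "- \<rho> (refl b) a \<in> roots" using A(3) D(3) by (intro root_minus root_rho) auto
      have pos: "- \<rho> (refl b) a \<in> pos_roots"
        using combination_pos[OF root r D(2) \<delta>_pos] True 4 by simp
      have "- \<rho> (inv w) (t *\<^sub>R b + (- q) *\<^sub>R \<delta>) = t *\<^sub>R (- \<rho> (inv w) b) + (- q) *\<^sub>R (- \<rho> (inv w) \<delta>)"
        using w by simp
      then have r': "- \<rho> (inv w) (- \<rho> (refl b) a) =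
          t *\<^sub>R (- \<rho> (inv w) b) + (- q) *\<^sub>R (- \<rho> (inv w) \<delta>)"
        unfolding r .
      have "- \<rho> (inv w) (- \<rho> (refl b) a) \<in> roots"
        by (rule root_minus[OF root_rho[OF root inv_closed[OF w]]])
      moreover have "- \<rho> (inv w) b \<in> pos_roots" "- \<rho> (inv w) \<delta> \<in> pos_roots"
        using D(1) \<delta>(4) w by (auto simp: inversions_iff)
      ultimately have "- \<rho> (inv w) (- \<rho> (refl b) a) \<in> pos_roots"
        using combination_pos[OF _ r'] True 4 by simp
      then have "- \<rho> (refl b) a \<in> inversions w" using pos w by (simp add: inversions_iff)
      moreover have "a \<in> inversions (refl b)" using pos A(2) D(3) by (simp add: inversions_refl_iff)
      ultimately show False using short_inversion_partner[OF w b _ A(1) ne] by blast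
    next
      case False
      have "(- q) *\<^sub>R \<delta>' = a + (- t) *\<^sub>R b" by (subst eq) simp
      then have "- \<rho> (inv w) ((- q) *\<^sub>R \<delta>') = - \<rho> (inv w) (a + (- t) *\<^sub>R b)" by simp
      then have "(- q) *\<^sub>R (- \<rho> (inv w) \<delta>') = (- \<rho> (inv w) a) + (- t) *\<^sub>R (- \<rho> (inv w) b)"
        using w by simp
      moreover have "- \<rho> (inv w) a \<in> cone" "- \<rho> (inv w) b \<in> cone"
        using A(1) D(1) w by (auto simp: inversions_iff pos_roots_iff)
      ultimately have "(- q) *\<^sub>R (- \<rho> (inv w) \<delta>') \<in> cone"
        using False cone_add cone_scale by (metis neg_0_le_iff_le not_less)
      moreover have "- \<rho> (inv w) \<delta>' \<in> roots"
        by (rule root_minus[OF root_rho[OF pos_root[OF \<delta>'(1)] inv_closed[OF w]]])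
      ultimately have "- \<rho> (inv w) \<delta>' \<in> pos_roots"
        using 4 pos_of_positive_multiple by (metis neg_0_less_iff_less)
      then show False using \<delta>' w by (simp add: inversions_iff)
    qed
  qed
qed

lemma short_step_inv:
  assumes w: "w \<in> carrier W" and step: "short_step w a b"
  shows "short_step (inv w) (- \<rho> (inv w) b) (- \<rho> (inv w) a)"
proof -
  have ab: "a \<in> short_inversions w" "b \<in> short_inversions w" "a \<noteq> b" "\<not> plane_simple (span {a, b}) b"
    using step by (auto simp: short_step_iff[OF w])
  moreover have "- \<rho> (inv w) b \<noteq> - \<rho> (inv w) a"
    using ab(3) w by (auto simp: rho_eq_iff)
  ultimately show ?thesis
    using nonsimple_reversed[OF w ab] w by (simp add: short_step_iff short_inversion_inv)
qed

lemma right_descent_roots_eq: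
  assumes w: "w \<in> carrier W"
  shows "right_descent_roots w = {b \<in> short_inversions w. - \<rho> (inv w) b \<in> simple_roots}"
proof (intro Set.set_eqI iffI)
  fix b assume "b \<in> right_descent_roots w"
  then obtain s where s: "b = - \<rho> w (\<alpha> s)" "s \<in> S" "len (w \<otimes> s) < len w"
    by (auto simp: right_descent_roots_def)
  then have len: "len w = len (w \<otimes> s) + 1" using len_mult_gen[OF w s(2)] by linarith
  then have "b \<in> cone" using descent_negative[OF w s(2)] s(1) by simp
  moreover have root: "\<rho> w (\<alpha> s) \<in> roots" using w s(2) by (intro root_rho simple_root)
  ultimately have "b \<in> pos_roots" using s(1) by (simp add: pos_roots_iff root_minus)
  moreover have "refl b \<otimes> w = w \<otimes> s"
    using w s(2) root by (simp add: s(1) refl_rho_simple m_assoc)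
  ultimately have "b \<in> short_inversions w" using len by (simp add: short_inversions_def)
  moreover have "- \<rho> (inv w) b = \<alpha> s" using w s(1) by simp
  ultimately show "b \<in> {b \<in> short_inversions w. - \<rho> (inv w) b \<in> simple_roots}"
    using s(2) by (simp add: simple_roots_def)
next
  fix b assume "b \<in> {b \<in> short_inversions w. - \<rho> (inv w) b \<in> simple_roots}"
  then obtain s where b: "b \<in> short_inversions w" and s: "s \<in> S" "- \<rho> (inv w) b = \<alpha> s"
    by (auto simp: simple_roots_def)
  have "b = \<rho> w (- (- \<rho> (inv w) b))" using w by simp
  then have b_eq: "b = - \<rho> w (\<alpha> s)" unfolding s(2) using w by simp
  have "\<rho> w (\<alpha> s) \<in> roots" using w s(1) by (intro root_rho simple_root)
  then have "refl b \<otimes> w = w \<otimes> s" using w s(1) by (simp add: b_eq refl_rho_simple m_assoc)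
  then have "len (w \<otimes> s) < len w" using short_inversionD(4)[OF w b] by simp
  then show "b \<in> right_descent_roots w" using b_eq s(1) by (auto simp: right_descent_roots_def)
qed

lemma exists_right_descent_above:
  assumes w: "w \<in> carrier W" and \<beta>: "\<beta> \<in> short_inversions w"
  shows "\<exists>c\<in>right_descent_roots w. (short_step w)\<^sup>*\<^sup>* \<beta> c"
proof -
  let ?b = "- \<rho> (inv w) \<beta>"
  obtain a where a: "a \<in> left_descent_roots (inv w)" "(short_step (inv w))\<^sup>*\<^sup>* a ?b"
    using exists_left_descent_below[of "inv w" ?b] short_inversion_inv[OF w \<beta>] w by auto
  have "(short_step w)\<^sup>*\<^sup>* (- \<rho> w y) (- \<rho> w a)" if "(short_step (inv w))\<^sup>*\<^sup>* a y" for y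
    using that
  proof induction
    case (step y z)
    then show ?case
      using short_step_inv[of "inv w" y z] w by (simp add: converse_rtranclp_into_rtranclp)
  qed simp
  from this[OF a(2)] have "(short_step w)\<^sup>*\<^sup>* \<beta> (- \<rho> w a)" using w by simp
  moreover have "- \<rho> w a \<in> right_descent_roots w"
    using a(1) w short_inversion_inv[of "inv w" a]
    by (simp add: left_descent_roots_eq right_descent_roots_eq)
  ultimately show ?thesis by blast
qed

lemma short_le_bounds:
  assumes w: "w \<in> carrier W" and \<beta>: "\<beta> \<in> short_inversions w"
  shows "\<exists>a\<in>left_descent_roots w. \<exists>c\<in>right_descent_roots w. short_le w a \<beta> \<and> short_le w \<beta> c"
  using exists_left_descent_below[OF w \<beta>] exists_right_descent_above[OF w \<beta>] \<beta>
  unfolding short_le_def left_descent_roots_eq[OF w] right_descent_roots_eq[OF w] by blast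

lemma no_step_to_left_descent:
  assumes w: "w \<in> carrier W" and "b \<in> left_descent_roots w"
  shows "\<not> short_step w a b"
  using assms simple_plane_simple[of _ "span {a, b}"] span_base[of b "{a, b}"]
  by (auto simp: left_descent_roots_eq short_step_iff simple_roots_def)

lemma no_step_from_right_descent:
  assumes w: "w \<in> carrier W" and b: "b \<in> right_descent_roots w"
  shows "\<not> short_step w b c"
proof
  assume "short_step w b c"
  then have "short_step (inv w) (- \<rho> (inv w) c) (- \<rho> (inv w) b)" by (rule short_step_inv[OF w])
  moreover have "- \<rho> (inv w) b \<in> left_descent_roots (inv w)"
    using b w short_inversion_inv[OF w] by (simp add: left_descent_roots_eq right_descent_roots_eq)
  ultimately show False using no_step_to_left_descent[of "inv w"] w by simp
qed

lemma minimal_short_inversions_eq: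
  assumes w: "w \<in> carrier W"
  shows "minimal_short_inversions w = left_descent_roots w"
proof (intro Set.set_eqI iffI)
  fix b assume b: "b \<in> minimal_short_inversions w"
  then have short: "b \<in> short_inversions w" by (simp add: minimal_short_inversions_def)
  then obtain a where "a \<in> left_descent_roots w" "short_le w a b" using short_le_bounds[OF w] by blast
  then show "b \<in> left_descent_roots w" using b by (auto simp: minimal_short_inversions_def short_le_def)
next
  fix b assume b: "b \<in> left_descent_roots w"
  have "a = b" if "short_le w a b" for a
    using that no_step_to_left_descent[OF w b] unfolding short_le_def by (metis rtranclp.cases)
  then show "b \<in> minimal_short_inversions w"
    using b by (auto simp: minimal_short_inversions_def left_descent_roots_eq[OF w])
qed

lemma maximal_short_inversions_eq:
  assumes w: "w \<in> carrier W"
  shows "maximal_short_inversions w = right_descent_roots w"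
proof (intro Set.set_eqI iffI)
  fix b assume b: "b \<in> maximal_short_inversions w"
  then have short: "b \<in> short_inversions w" by (simp add: maximal_short_inversions_def)
  then obtain c where "c \<in> right_descent_roots w" "short_le w b c" using short_le_bounds[OF w] by blast
  then show "b \<in> right_descent_roots w" using b by (auto simp: maximal_short_inversions_def short_le_def)
next
  fix b assume b: "b \<in> right_descent_roots w"
  have "c = b" if "short_le w b c" for c
    using that no_step_from_right_descent[OF w b] unfolding short_le_def by (metis converse_rtranclpE)
  then show "b \<in> maximal_short_inversions w"
    using b by (auto simp: maximal_short_inversions_def right_descent_roots_eq[OF w])
qed

end

theorem theorem3p17:
  fixes W :: "'w monoid" and S :: "'w set"
    and \<rho> :: "'w \<Rightarrow> 'v::real_vector \<Rightarrow> 'v"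
    and B :: "'v \<Rightarrow> 'v \<Rightarrow> real" and \<alpha> :: "'w \<Rightarrow> 'v" and w :: 'w
  assumes "geometric_representation W S \<rho> B \<alpha>"
    and "w \<in> carrier W"
  shows "geometric_representation.minimal_short_inversions W S \<rho> B \<alpha> w =
      geometric_representation.left_descent_roots W S \<rho> \<alpha> w \<and>
    geometric_representation.maximal_short_inversions W S \<rho> B \<alpha> w =
      geometric_representation.right_descent_roots W S \<rho> \<alpha> w \<and>
    (\<forall>\<beta> \<in> geometric_representation.short_inversions W S \<rho> B \<alpha> w.
      \<exists>a \<in> geometric_representation.left_descent_roots W S \<rho> \<alpha> w.
      \<exists>c \<in> geometric_representation.right_descent_roots W S \<rho> \<alpha> w.
        geometric_representation.short_le W S \<rho> B \<alpha> w a \<beta> \<and>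
        geometric_representation.short_le W S \<rho> B \<alpha> w \<beta> c)"
proof -
  interpret geometric_representation W S \<rho> B \<alpha> by (rule assms(1))
  show ?thesis
    using minimal_short_inversions_eq maximal_short_inversions_eq short_le_bounds assms(2) by auto
qed

end
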